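(* There is a function $\varepsilon(n)\to0$ as $n\to\infty$ such that for every $n$, every $T\le n$, and every symmetric strategy $\mathcal{D}$ on $K_n$, there is a symmetric strategy $\mathcal{D}'$ of Anderson-Weber type with \[ \Pr_{\mathcal{D}'}[\tau\ge T]\le \Pr_{\mathcal{D}}[\tau\ge T]+\varepsilon(n). \] That is, for $T\le n$, $\Pr[\tau\ge T]$ is minimized over all symmetric strategies, up to an additive $o(1)$, by a strategy of Anderson-Weber type.
   Context: Rendezvous on the complete graph $K_n$: there are $n$ locations; each of two players labels them privately by $[n]$, and the labelings differ by a uniformly random permutation $\pi$ of $[n]$. A walk schedule is an infinite sequence of labels; a player with schedule $\mathbf{x}$ visits at step $t$ the location she labels $x_t$; the players meet at step $t$ iff $x_t=\pi(y_t)$, and $\tau=\min\{t:x_t=\pi(y_t)\}$. A symmetric strategy is a distribution $\mathcal{D}$ over walk schedules, with both players sampling independently from $\mathcal{D}$ (and $\pi$ independent); $\Pr_{\mathcal{D}}$ denotes probability under this experiment. A strategy is of Anderson-Weber type if for each $j=0,1,2,\dots$, with probability one, the subsequence of the schedule on steps $jn+1,\dots,(j+1)n$ is either the constant sequence $(n,n,\dots,n)$ or a permutation of $1,\dots,n$. *)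

theory Defs
  imports "HOL-Probability.Probability" "HOL-Combinatorics.Permutations"
begin

text \<open>Schedules are indexed by the steps \<open>1, 2, \<dots>\<close>; a schedule \<open>x\<close> is an element of
  \<open>{1..} \<rightarrow>\<^sub>E {1..n}\<close>, so its value at \<open>0\<close> is \<^term>\<open>undefined\<close> and plays no role.\<close>

definition schedule_space :: "nat \<Rightarrow> (nat \<Rightarrow> nat) measure" where
  "schedule_space n = (\<Pi>\<^sub>M t\<in>{1..}. count_space {1..n})"

definition symmetric_strategy :: "nat \<Rightarrow> (nat \<Rightarrow> nat) measure \<Rightarrow> bool" where
  "symmetric_strategy n D \<longleftrightarrow> prob_space D \<and> sets D = sets (schedule_space n)"

definition meeting_time :: "(nat \<Rightarrow> nat) \<Rightarrow> (nat \<Rightarrow> nat) \<Rightarrow> (nat \<Rightarrow> nat) \<Rightarrow> enat" where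
  "meeting_time x y \<pi> = (INF t\<in>{t. 1 \<le> t \<and> x t = \<pi> (y t)}. enat t)"
  \<comment> \<open>The infimum of the empty set is \<open>\<infinity>\<close>: the players never meet.\<close>

definition rendezvous ::
  "nat \<Rightarrow> (nat \<Rightarrow> nat) measure \<Rightarrow> ((nat \<Rightarrow> nat) \<times> (nat \<Rightarrow> nat) \<times> (nat \<Rightarrow> nat)) measure" where
  "rendezvous n D = D \<Otimes>\<^sub>M (D \<Otimes>\<^sub>M uniform_count_measure {\<pi>. \<pi> permutes {1..n}})"

definition prob_meeting_ge :: "nat \<Rightarrow> (nat \<Rightarrow> nat) measure \<Rightarrow> nat \<Rightarrow> real" where
  "prob_meeting_ge n D T = \<P>((x, y, \<pi>) in rendezvous n D. enat T \<le> meeting_time x y \<pi>)"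

definition anderson_weber_type :: "nat \<Rightarrow> (nat \<Rightarrow> nat) measure \<Rightarrow> bool" where
  "anderson_weber_type n D \<longleftrightarrow>
     (\<forall>j. AE x in D. (\<forall>t\<in>{j * n + 1..(j + 1) * n}. x t = n) \<or>
                     bij_betw x {j * n + 1..(j + 1) * n} {1..n})"

end

theory Submission
  imports Defs "HOL-Real_Asymp.Real_Asymp"
begin

text \<open>
  Let \<open>m = T - 1\<close> and \<open>s = m / n\<close>. Call a step of a schedule heavy if its label is visited more
  than about \<open>n powr (3 / 4)\<close> times during the first \<open>m\<close> steps. For two fixed schedules let
  \<open>\<mu>\<close>, \<open>\<nu>\<close>, \<open>l\<close>, \<open>\<eta>\<close> be the numbers, divided by \<open>n\<close>, of steps that are heavy for the second
  player only, the first only, neither and both. Switching values of permutations shows that the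
  players fail to meet with probability at least \<open>(1 - \<mu>) * (1 - \<nu>) * exp (- l) - o(1)\<close>.
  An elementary inequality bounds this below by the linear interpolation of its corner values
  plus \<open>exp (- s) * (\<mu> * \<nu> - \<eta> * l)\<close>. This bound is a polynomial in the heavy fractions of the
  two schedules and their overlap in which the overlap has a nonnegative coefficient. Averaged
  over independent copies the overlap is at least the square \<open>p\<^sup>2\<close> of the mean heavy fraction
  \<open>p\<close>, and the bound becomes
  \<open>p\<^sup>2 + 2 * p * (1 - p) * (1 - s) + (1 - p)\<^sup>2 * exp (- s)\<close>. Up to \<open>o(1)\<close> this is what the
  Anderson-Weber strategy achieves that stays put with probability \<open>p\<close> and otherwise tours
  all locations.
\<close>

section \<open>Permutations avoiding forbidden pairs\<close>

text \<open>For \<open>E \<subseteq> S \<times> S\<close> with S finite, the cardinality of this set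
  is the permanent of the 0-1 matrix on S that vanishes exactly on E.\<close>

definition avoiding :: "'a set \<Rightarrow> ('a \<times> 'a) set \<Rightarrow> ('a \<Rightarrow> 'a) set" where
  "avoiding S E = {\<pi>. \<pi> permutes S \<and> (\<forall>(u, v)\<in>E. \<pi> u \<noteq> v)}"

lemma finite_avoiding [simp]: "finite S \<Longrightarrow> finite (avoiding S E)"
  by (rule finite_subset[OF _ finite_permutations[of S]]) (auto simp: avoiding_def)

lemma avoiding_empty [simp]: "finite S \<Longrightarrow> card (avoiding S {}) = fact (card S)"
  by (simp add: avoiding_def card_permutations)

lemma avoiding_antimono: "E \<subseteq> F \<Longrightarrow> avoiding S F \<subseteq> avoiding S E"
  by (auto simp: avoiding_def)

lemma card_avoiding_le_fact: "finite S \<Longrightarrow> card (avoiding S E) \<le> fact (card S)"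
  by (metis avoiding_antimono avoiding_empty card_mono empty_subsetI finite_avoiding)

lemma avoiding_insert:
  "avoiding S E = avoiding S (insert (u, v) E) \<union> {\<pi> \<in> avoiding S E. \<pi> u = v}"
  by (auto simp: avoiding_def)

lemma card_avoiding_insert:
  assumes "finite S"
  shows "card (avoiding S E) =
    card (avoiding S (insert (u, v) E)) + card {\<pi> \<in> avoiding S E. \<pi> u = v}"
proof -
  have "avoiding S (insert (u, v) E) \<inter> {\<pi> \<in> avoiding S E. \<pi> u = v} = {}"
    by (auto simp: avoiding_def)
  then show ?thesis
    using assms by (subst avoiding_insert[of S E u v], subst card_Un_disjoint) auto
qed

lemma comp_transpose_cancel:
  "\<pi> \<circ> Transposition.transpose a b = \<rho> \<circ> Transposition.transpose a b \<Longrightarrow> \<pi> = \<rho>"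
  by (metis comp_assoc comp_id transpose_comp_involutory)

text \<open>Switching: from a permutation through \<open>(u, v)\<close>, swapping the values at \<open>u\<close> and at a
  further point stays within the avoiding permutations except for at most as many points as
  there are forbidden pairs at \<open>u\<close> or at \<open>v\<close>; the swap is undone by looking up the preimage
  of \<open>v\<close>.\<close>

lemma card_through_edge_le:
  assumes fin: "finite S" "finite E" and u: "u \<in> S" and v: "v \<in> S"
  shows "card {\<pi> \<in> avoiding S E. \<pi> u = v} * (card S - (card (E `` {u}) + card (E\<inverse> `` {v})))
    \<le> card (avoiding S E)"
proof -
  define Z where "Z = {\<pi> \<in> avoiding S E. \<pi> u = v}"
  \<comment> \<open>The swap sends u to \<open>\<pi> w\<close> and w to v; \<open>G \<pi>\<close>
    holds those w for which neither new pair is forbidden.\<close>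
  define G where "G \<pi> = {w \<in> S. (u, \<pi> w) \<notin> E \<and> (w, v) \<notin> E}" for \<pi>
  let ?d = "card (E `` {u}) + card (E\<inverse> `` {v})"
  have finE: "finite (E `` {u})" "finite (E\<inverse> `` {v})"
    using fin(2) by (auto intro: finite_Image)
  have finZ: "finite Z" using fin by (simp add: Z_def)
  have G: "card S - ?d \<le> card (G \<pi>)" if "\<pi> \<in> Z" for \<pi>
  proof -
    have p: "\<pi> permutes S" using that by (auto simp: Z_def avoiding_def)
    have "S - G \<pi> \<subseteq> (\<pi> -` (E `` {u})) \<union> E\<inverse> `` {v}" by (auto simp: G_def)
    then have "card (S - G \<pi>) \<le> card ((\<pi> -` (E `` {u})) \<union> E\<inverse> `` {v})"
      using finE p by (intro card_mono) (auto intro!: finite_vimageI simp: permutes_inj)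
    also have "\<dots> \<le> card (\<pi> -` (E `` {u})) + card (E\<inverse> `` {v})" by (rule card_Un_le)
    also have "card (\<pi> -` (E `` {u})) = card (E `` {u})"
      using p by (intro card_vimage_inj) (auto simp: permutes_inj permutes_surj)
    finally have "card (S - G \<pi>) \<le> ?d" .
    moreover have "card (S - G \<pi>) = card S - card (G \<pi>)"
      using fin by (intro card_Diff_subset) (auto simp: G_def)
    ultimately show ?thesis by simp
  qed
  let ?f = "\<lambda>(\<pi>, w). \<pi> \<circ> Transposition.transpose u w"
  have inj: "inj_on ?f (Sigma Z G)"
  proof (rule inj_onI, clarsimp)
    fix \<pi> w \<rho> z
    assume a: "\<pi> \<in> Z" "\<rho> \<in> Z" and eq: "\<pi> \<circ> Transposition.transpose u w = \<rho> \<circ> Transposition.transpose u z"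
    have "(\<pi> \<circ> Transposition.transpose u w) w = v" "(\<rho> \<circ> Transposition.transpose u z) z = v"
      using a by (auto simp: Z_def)
    moreover have "inj (\<rho> \<circ> Transposition.transpose u z)"
      using a(2) by (intro inj_compose) (auto simp: Z_def avoiding_def permutes_inj)
    ultimately have "(\<rho> \<circ> Transposition.transpose u z) w = (\<rho> \<circ> Transposition.transpose u z) z"
      and "inj (\<rho> \<circ> Transposition.transpose u z)"
      by (simp_all add: eq)
    then have "w = z" by (rule injD[rotated])
    then show "\<pi> = \<rho> \<and> w = z" 
      using comp_transpose_cancel[of \<pi> u z \<rho>] eq by simp
  qed
  have im: "?f ` (Sigma Z G) \<subseteq> avoiding S E"
  proof clarify
    fix \<pi> w assume a: "\<pi> \<in> Z" "w \<in> G \<pi>"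
    have p: "\<pi> permutes S" and uv: "\<pi> u = v" and av: "\<And>i j. (i, j) \<in> E \<Longrightarrow> \<pi> i \<noteq> j"
      using a(1) by (auto simp: Z_def avoiding_def)
    have "\<pi> \<circ> Transposition.transpose u w permutes S"
      using a(2) u p by (intro permutes_compose permutes_swap_id) (auto simp: G_def)
    moreover have "(\<pi> \<circ> Transposition.transpose u w) i \<noteq> j" if "(i, j) \<in> E" for i j
      using that a(2) uv av[OF that] by (auto simp: G_def Transposition.transpose_def)
    ultimately show "\<pi> \<circ> Transposition.transpose u w \<in> avoiding S E" by (auto simp: avoiding_def)
  qed
  have "card Z * (card S - ?d) = (\<Sum>\<pi>\<in>Z. card S - ?d)" by simp
  also have "\<dots> \<le> (\<Sum>\<pi>\<in>Z. card (G \<pi>))" by (intro sum_mono G)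
  also have "\<dots> = card (Sigma Z G)"
    using finZ fin by (intro card_SigmaI[symmetric]) (auto simp: G_def)
  also have "\<dots> = card (?f ` (Sigma Z G))" by (rule card_image[OF inj, symmetric])
  also have "\<dots> \<le> card (avoiding S E)" using fin im by (intro card_mono) auto
  finally show ?thesis by (simp add: Z_def)
qed

text \<open>The switching run the other way: swapping the values of an avoiding permutation at u and
  at the preimage w of v makes it pass through \<open>(u, v)\<close>. Together with w the image
  determines the permutation, hence the factor \<open>card S\<close>. The swap creates the pair
  \<open>(w, \<pi> u)\<close>; the last summand counts the permutations for which that pair is
  forbidden.\<close>

lemma card_avoiding_le_through_edge:
  assumes fin: "finite S" and u: "u \<in> S" and v: "v \<in> S" and uv: "(u, v) \<notin> E"
  shows "card (avoiding S E) \<le> card S * card {\<pi> \<in> avoiding S E. \<pi> u = v} +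
    card {\<pi>. \<pi> permutes S \<and> (\<exists>w. \<pi> w = v \<and> (w, \<pi> u) \<in> E)}"
proof -
  define Z where "Z = {\<pi> \<in> avoiding S E. \<pi> u = v}"
  define B where "B = {\<pi>. \<pi> permutes S \<and> (\<exists>w. \<pi> w = v \<and> (w, \<pi> u) \<in> E)}"
  let ?f = "\<lambda>\<pi>. (inv \<pi> v, \<pi> \<circ> Transposition.transpose u (inv \<pi> v))"
  have finB: "finite B"
    by (rule finite_subset[OF _ finite_permutations[OF fin]]) (auto simp: B_def)
  have inj: "inj_on ?f (avoiding S E - B)"
  proof (rule inj_onI)
    fix \<pi> \<rho> assume "?f \<pi> = ?f \<rho>"
    then have "inv \<pi> v = inv \<rho> v \<and> \<pi> \<circ> Transposition.transpose u (inv \<pi> v) =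
        \<rho> \<circ> Transposition.transpose u (inv \<rho> v)"
      unfolding prod.inject .
    then show "\<pi> = \<rho>" using comp_transpose_cancel[of \<pi> u "inv \<rho> v" \<rho>] by auto
  qed
  have im: "?f ` (avoiding S E - B) \<subseteq> S \<times> Z"
  proof clarify
    fix \<pi> assume a: "\<pi> \<in> avoiding S E" "\<pi> \<notin> B"
    define w where "w = inv \<pi> v"
    have p: "\<pi> permutes S" and av: "\<And>i j. (i, j) \<in> E \<Longrightarrow> \<pi> i \<noteq> j"
      using a(1) by (auto simp: avoiding_def)
    have wv: "\<pi> w = v" using p by (simp add: w_def permutes_inverses)
    then have wS: "w \<in> S" using v permutes_in_image[OF p] by metis
    have nb: "(w, \<pi> u) \<notin> E" using a(2) p wv by (auto simp: B_def)
    have "\<pi> \<circ> Transposition.transpose u w permutes S"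
      using wS u p by (intro permutes_compose permutes_swap_id) auto
    moreover have "(\<pi> \<circ> Transposition.transpose u w) i \<noteq> j" if "(i, j) \<in> E" for i j
      using that nb wv uv av[OF that] by (auto simp: Transposition.transpose_def)
    ultimately show "inv \<pi> v \<in> S \<and> \<pi> \<circ> Transposition.transpose u (inv \<pi> v) \<in> Z"
      using wS wv by (auto simp: avoiding_def Z_def w_def)
  qed
  have "card (avoiding S E) \<le> card ((avoiding S E - B) \<union> B)"
    using fin finB by (intro card_mono) auto
  also have "\<dots> \<le> card (avoiding S E - B) + card B" by (rule card_Un_le)
  also have "card (avoiding S E - B) = card (?f ` (avoiding S E - B))"
    by (rule card_image[OF inj, symmetric])
  also have "\<dots> \<le> card (S \<times> Z)" using fin im by (intro card_mono) (auto simp: Z_def)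
  also have "\<dots> = card S * card Z" by (rule card_cartesian_product)
  finally show ?thesis by (simp add: B_def Z_def)
qed

text \<open>Without forbidden pairs neither switching loses anything, so the two bounds
  meet.\<close>

lemma card_permutations_through_edge:
  assumes "finite S" "u \<in> S" "v \<in> S"
  shows "card S * card {\<pi>. \<pi> permutes S \<and> \<pi> u = v} = fact (card S)"
proof (rule antisym)
  show "card S * card {\<pi>. \<pi> permutes S \<and> \<pi> u = v} \<le> fact (card S)"
    using card_through_edge_le[of S "{}" u v] assms
    by (simp add: avoiding_def card_permutations mult.commute)
  show "fact (card S) \<le> card S * card {\<pi>. \<pi> permutes S \<and> \<pi> u = v}"
    using card_avoiding_le_through_edge[of S u v "{}"] assms
    by (simp add: avoiding_def card_permutations)
qed

lemma card_avoiding_Un_ge_subtract: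
  assumes fin: "finite S" "finite F"
  shows "real (card (avoiding S (E \<union> F))) \<ge> real (card (avoiding S E)) -
    (\<Sum>(u, v)\<in>F. real (card {\<pi> \<in> avoiding S E. \<pi> u = v}))"
proof -
  have "avoiding S E \<subseteq> avoiding S (E \<union> F) \<union> (\<Union>(u, v)\<in>F. {\<pi> \<in> avoiding S E. \<pi> u = v})"
    by (auto simp: avoiding_def)
  then have "card (avoiding S E) \<le>
      card (avoiding S (E \<union> F) \<union> (\<Union>(u, v)\<in>F. {\<pi> \<in> avoiding S E. \<pi> u = v}))"
    using fin by (intro card_mono) auto
  also have "\<dots> \<le> card (avoiding S (E \<union> F)) + card (\<Union>(u, v)\<in>F. {\<pi> \<in> avoiding S E. \<pi> u = v})"
    by (rule card_Un_le)
  also have "card (\<Union>(u, v)\<in>F. {\<pi> \<in> avoiding S E. \<pi> u = v}) \<le>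
      (\<Sum>e\<in>F. card (case e of (u, v) \<Rightarrow> {\<pi> \<in> avoiding S E. \<pi> u = v}))"
    by (rule card_UN_le[OF fin(2)])
  finally have "real (card (avoiding S E)) \<le> real (card (avoiding S (E \<union> F)) +
      (\<Sum>e\<in>F. card (case e of (u, v) \<Rightarrow> {\<pi> \<in> avoiding S E. \<pi> u = v})))"
    by (simp only: of_nat_le_iff add_le_cancel_left)
  then show ?thesis by (simp add: case_prod_unfold)
qed

text \<open>Union bound over the pairs of F, each estimated by \<open>card_through_edge_le\<close>.
  Only degrees in E enter, so F may contain full stars; the price is a loss linear in
  \<open>card F\<close>.\<close>

lemma card_avoiding_Un_ge:
  assumes fin: "finite S" "finite E" and F: "F \<subseteq> S \<times> S"
    and deg: "\<And>u v. (u, v) \<in> F \<Longrightarrow> card (E `` {u}) + card (E\<inverse> `` {v}) \<le> d" and d: "d < card S"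
  shows "real (card (avoiding S (E \<union> F))) \<ge>
    (1 - card F / (card S - d)) * real (card (avoiding S E))"
proof -
  have finF: "finite F" using F fin by (auto intro: finite_subset)
  have "(\<Sum>(u, v)\<in>F. real (card {\<pi> \<in> avoiding S E. \<pi> u = v})) \<le>
      (\<Sum>(u, v)\<in>F. real (card (avoiding S E)) / (card S - d))"
  proof (intro sum_mono, clarify)
    fix u v assume e: "(u, v) \<in> F"
    have "card {\<pi> \<in> avoiding S E. \<pi> u = v} * (card S - d) \<le>
      card {\<pi> \<in> avoiding S E. \<pi> u = v} * (card S - (card (E `` {u}) + card (E\<inverse> `` {v})))"
      using deg[OF e] by (intro mult_left_mono) auto
    also have "\<dots> \<le> card (avoiding S E)" using e F fin by (intro card_through_edge_le) auto
    finally have "real (card {\<pi> \<in> avoiding S E. \<pi> u = v}) * real (card S - d) \<le>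
        card (avoiding S E)"
      by (simp only: of_nat_le_iff flip: of_nat_mult)
    then show "real (card {\<pi> \<in> avoiding S E. \<pi> u = v}) \<le> card (avoiding S E) / (card S - d)"
      using d by (simp add: field_simps)
  qed
  then show ?thesis
    using card_avoiding_Un_ge_subtract[OF fin(1) finF, of E] by (simp add: algebra_simps)
qed

text \<open>Adding the pairs of F one at a time turns the linear loss into a product. Degrees are
  taken in \<open>E \<union> F\<close> because earlier pairs of F are already forbidden when a later
  one is added.\<close>

lemma card_avoiding_Un_ge_power:
  assumes fin: "finite S" "finite E" and F: "F \<subseteq> S \<times> S"
    and deg: "\<And>u v. (u, v) \<in> F \<Longrightarrow>
      card ((E \<union> F) `` {u}) + card ((E \<union> F)\<inverse> `` {v}) \<le> d"
    and d: "d < card S"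
  shows "real (card (avoiding S (E \<union> F))) \<ge>
    (1 - 1 / (card S - d)) ^ card F * real (card (avoiding S E))"
proof -
  have finF: "finite F" using F fin by (auto intro: finite_subset)
  have "real (card (avoiding S (E \<union> G))) \<ge>
      (1 - 1 / (card S - d)) ^ card G * real (card (avoiding S E))"
    if "finite G" "G \<subseteq> F" for G
    using that
  proof (induction G rule: finite_induct)
    case (insert e G)
    let ?q = "1 - 1 / real (card S - d)"
    have finEG: "finite (E \<union> G)" and finEF: "finite (E \<union> F)"
      using insert fin finF by auto
    have sub: "E \<union> G \<subseteq> E \<union> F" using insert by auto
    have "card ((E \<union> G) `` {u}) + card ((E \<union> G)\<inverse> `` {v}) \<le> d" if uv: "(u, v) \<in> {e}" for u v
    proof -
      have "card ((E \<union> G) `` {u}) + card ((E \<union> G)\<inverse> `` {v}) \<le>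
          card ((E \<union> F) `` {u}) + card ((E \<union> F)\<inverse> `` {v})"
        using sub finEF by (intro add_mono card_mono finite_Image) auto
      also have "\<dots> \<le> d" using uv insert.prems by (intro deg) auto
      finally show ?thesis .
    qed
    then have "real (card (avoiding S (E \<union> G \<union> {e}))) \<ge>
        (1 - card {e} / (card S - d)) * real (card (avoiding S (E \<union> G)))"
      using insert.prems F fin finEG d by (intro card_avoiding_Un_ge) auto
    moreover have "?q * real (card (avoiding S (E \<union> G))) \<ge>
        ?q * (?q ^ card G * real (card (avoiding S E)))"
      using insert d by (intro mult_left_mono) auto
    ultimately show ?case using insert.hyps by (simp add: mult.assoc)
  qed simp
  from this[OF finF] show ?thesis by simp
qed

text \<open>U and V contain all points of degree above k on the two sides. The pairs are added in an
  order that keeps the relevant degrees small: first those touching only U, then those touching only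
  V, both with a linear loss; then those touching neither, with the product bound; last the few
  pairs touching both, by a union bound.\<close>

lemma card_avoiding_ge:
  assumes fin: "finite S" and E: "E \<subseteq> S \<times> S"
    and U: "\<And>u. u \<in> S - U \<Longrightarrow> card (E `` {u}) \<le> k"
    and V: "\<And>v. v \<in> S - V \<Longrightarrow> card (E\<inverse> `` {v}) \<le> k"
    and finUV: "finite U" "finite V"
    and k: "2 * k < card S"
    and star: "card (E \<inter> U \<times> (- V)) \<le> card S" "card (E \<inter> (- U) \<times> V) \<le> card S"
  shows "real (card (avoiding S E)) / fact (card S) \<ge>
    (1 - card (E \<inter> U \<times> (- V)) / card S) * (1 - card (E \<inter> (- U) \<times> V) / card S) *
    (1 - 1 / (real (card S) - 2 * k)) ^ card (E \<inter> (- U) \<times> (- V)) - card U * card V / card S"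
proof -
  let ?N = "card S" and ?a = "\<lambda>E. real (card (avoiding S E))"
  let ?HL = "E \<inter> U \<times> (- V)" and ?LH = "E \<inter> (- U) \<times> V" and ?LL = "E \<inter> (- U) \<times> (- V)"
    and ?HH = "E \<inter> U \<times> V"
  have finE: "finite E" using E fin by (auto intro: finite_subset)
  have N: "0 < ?N" using k by auto
  have q: "0 \<le> 1 - 1 / (real ?N - 2 * k)"
    using k by (simp add: field_simps)
  have 1: "?a ?HL \<ge> (1 - card ?HL / ?N) * fact ?N"
    using card_avoiding_Un_ge[of S "{}" ?HL 0] fin E N by (simp add: le_infI1)
  \<comment> \<open>\<open>?HL\<close> has no pair with first entry outside U and none with second
    entry in V, so all degrees at the pairs of \<open>?LH\<close> are 0.\<close>
  have 2: "?a (?HL \<union> ?LH) \<ge> (1 - card ?LH / ?N) * ?a ?HL"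
  proof -
    have finHL: "finite ?HL" and FS: "?LH \<subseteq> S \<times> S" using finE E by auto
    have "?HL `` {u} = {}" "?HL\<inverse> `` {v} = {}" if "(u, v) \<in> ?LH" for u v
      using that by auto
    then have deg: "card (?HL `` {u}) + card (?HL\<inverse> `` {v}) \<le> 0" if "(u, v) \<in> ?LH" for u v
      using that by (metis add_0 card.empty le_refl)
    show ?thesis
      using card_avoiding_Un_ge[OF fin finHL FS deg N] by simp
  qed
  have 3: "?a (?HL \<union> ?LH \<union> ?LL) \<ge> (1 - 1 / (real ?N - 2 * k)) ^ card ?LL * ?a (?HL \<union> ?LH)"
  proof -
    have "card ((?HL \<union> ?LH \<union> ?LL) `` {u}) + card ((?HL \<union> ?LH \<union> ?LL)\<inverse> `` {v}) \<le> 2 * k"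
      if uv: "(u, v) \<in> ?LL" for u v
    proof -
      have "card ((?HL \<union> ?LH \<union> ?LL) `` {u}) \<le> card (E `` {u})"
        "card ((?HL \<union> ?LH \<union> ?LL)\<inverse> `` {v}) \<le> card (E\<inverse> `` {v})"
        using finE by (intro card_mono finite_Image; auto)+
      moreover have "card (E `` {u}) \<le> k" "card (E\<inverse> `` {v}) \<le> k"
        using uv E by (auto intro!: U V)
      ultimately show ?thesis by simp
    qed
    then show ?thesis
      using card_avoiding_Un_ge_power[of S "?HL \<union> ?LH" ?LL "2 * k"] fin finE E k
      by (simp add: le_infI1 of_nat_diff)
  qed
  \<comment> \<open>Degrees at pairs of \<open>?HH\<close> are uncontrolled. Each such pair removes
    at most the \<open>fact ?N / ?N\<close> permutations through it, and there are at most
    \<open>card U * card V\<close> of them.\<close>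
  have 4: "?a E \<ge> ?a (?HL \<union> ?LH \<union> ?LL) - card U * card V * (fact ?N / ?N)"
  proof -
    have "real (card {\<pi> \<in> avoiding S (?HL \<union> ?LH \<union> ?LL). \<pi> u = v}) \<le> fact ?N / ?N"
      if "(u, v) \<in> ?HH" for u v
    proof -
      have "card {\<pi> \<in> avoiding S (?HL \<union> ?LH \<union> ?LL). \<pi> u = v} \<le>
          card {\<pi>. \<pi> permutes S \<and> \<pi> u = v}"
        by (intro card_mono finite_subset[OF _ finite_permutations[OF fin]])
          (auto simp: avoiding_def)
      moreover have "real ?N * card {\<pi>. \<pi> permutes S \<and> \<pi> u = v} = fact ?N"
        using card_permutations_through_edge[of S u v] that E fin
        by (metis (no_types, lifting) IntD1 mem_Sigma_iff of_nat_fact of_nat_mult subsetD)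
      ultimately have "real ?N * card {\<pi> \<in> avoiding S (?HL \<union> ?LH \<union> ?LL). \<pi> u = v} \<le> fact ?N"
        using mult_left_mono[of "real (card {\<pi> \<in> avoiding S (?HL \<union> ?LH \<union> ?LL). \<pi> u = v})"
          "real (card {\<pi>. \<pi> permutes S \<and> \<pi> u = v})" "real ?N"] by simp
      then show ?thesis using N by (simp add: field_simps)
    qed
    then have "(\<Sum>(u, v)\<in>?HH. real (card {\<pi> \<in> avoiding S (?HL \<union> ?LH \<union> ?LL). \<pi> u = v})) \<le>
        (\<Sum>(u, v)\<in>?HH. fact ?N / ?N)"
      by (intro sum_mono) auto
    also have "\<dots> = card ?HH * (fact ?N / ?N)" by simp
    also have "\<dots> \<le> (card U * card V) * (fact ?N / ?N)"
    proof (rule mult_right_mono)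
      have "card ?HH \<le> card (U \<times> V)" using finUV by (intro card_mono) auto
      then show "real (card ?HH) \<le> card U * card V"
        by (metis card_cartesian_product of_nat_le_iff)
    qed simp
    finally have "(\<Sum>(u, v)\<in>?HH. real (card {\<pi> \<in> avoiding S (?HL \<union> ?LH \<union> ?LL). \<pi> u = v})) \<le>
        (card U * card V) * (fact ?N / ?N)" .
    moreover have "?HL \<union> ?LH \<union> ?LL \<union> ?HH = E" by auto
    ultimately show ?thesis
      using card_avoiding_Un_ge_subtract[of S ?HH "?HL \<union> ?LH \<union> ?LL"] fin finE by simp
  qed
  have "?a (?HL \<union> ?LH \<union> ?LL) \<ge> (1 - 1 / (real ?N - 2 * k)) ^ card ?LL *
      ((1 - card ?LH / ?N) * ((1 - card ?HL / ?N) * fact ?N))"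
  proof -
    have "(1 - card ?LH / ?N) * ((1 - card ?HL / ?N) * fact ?N) \<le> (1 - card ?LH / ?N) * ?a ?HL"
      using 1 star N by (intro mult_left_mono) (auto simp: field_simps)
    also have "\<dots> \<le> ?a (?HL \<union> ?LH)" by (rule 2)
    finally show ?thesis
      by (intro order_trans[OF mult_left_mono 3] zero_le_power q)
  qed
  with 4 have "(1 - 1 / (real ?N - 2 * k)) ^ card ?LL *
      ((1 - card ?LH / ?N) * ((1 - card ?HL / ?N) * fact ?N)) -
      card U * card V * (fact ?N / ?N) \<le> ?a E"
    by linarith
  also have "(1 - 1 / (real ?N - 2 * k)) ^ card ?LL *
      ((1 - card ?LH / ?N) * ((1 - card ?HL / ?N) * fact ?N)) -
      card U * card V * (fact ?N / ?N) =
    ((1 - card ?HL / ?N) * (1 - card ?LH / ?N) * (1 - 1 / (real ?N - 2 * k)) ^ card ?LL -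
      card U * card V / ?N) * fact ?N"
  proof -
    have "q * ((1 - h) * ((1 - g) * f)) - u * (f / n) = ((1 - g) * (1 - h) * q - u / n) * f"
      for q h g f u n :: real
      by (simp add: algebra_simps)
    then show ?thesis .
  qed
  finally show ?thesis by (simp add: pos_le_divide_eq)
qed

section \<open>Forbidden pairs forming a star or lying on the diagonal\<close>

text \<open>Two distinct pairs of F share an entry in the same position, so no permutation passes
  through both and the union bound is exact.\<close>

lemma card_avoiding_star:
  assumes fin: "finite S" "S \<noteq> {}" and F: "F \<subseteq> S \<times> S"
    and star: "\<And>e e'. e \<in> F \<Longrightarrow> e' \<in> F \<Longrightarrow> fst e = fst e' \<or> snd e = snd e'"
  shows "real (card (avoiding S F)) / fact (card S) = 1 - card F / card S"
proof -
  define Z where "Z e = {\<pi>. \<pi> permutes S \<and> \<pi> (fst e) = snd e}" for e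
  have finF: "finite F" using F fin by (auto intro: finite_subset)
  have finZ: "finite (Z e)" for e
    by (rule finite_subset[OF _ finite_permutations[OF fin(1)]]) (auto simp: Z_def)
  have N: "0 < card S" using fin by (simp add: card_gt_0_iff)
  have Z: "real (card (Z e)) = fact (card S) / card S" if "e \<in> F" for e
  proof -
    have "card S * card (Z e) = fact (card S)"
      unfolding Z_def using that F fin by (intro card_permutations_through_edge) auto
    then have "real (card S) * card (Z e) = fact (card S)" by (metis of_nat_fact of_nat_mult)
    then show ?thesis using N by (simp add: field_simps)
  qed
  have disj: "Z e \<inter> Z e' = {}" if "e \<in> F" "e' \<in> F" "e \<noteq> e'" for e e'
  proof (rule equals0I)
    fix \<pi> assume "\<pi> \<in> Z e \<inter> Z e'"
    then have "\<pi> permutes S" "\<pi> (fst e) = snd e" "\<pi> (fst e') = snd e'" by (auto simp: Z_def)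
    then show False using star[OF that(1,2)] that(3) by (metis injD permutes_inj prod_eqI)
  qed
  have "{\<pi>. \<pi> permutes S} = avoiding S F \<union> (\<Union>e\<in>F. Z e)"
    by (auto simp: avoiding_def Z_def)
  then have "fact (card S) = card (avoiding S F \<union> (\<Union>e\<in>F. Z e))"
    using card_permutations[OF refl fin(1)] by metis
  also have "\<dots> = card (avoiding S F) + card (\<Union>e\<in>F. Z e)"
    using fin finF finZ
    by (intro card_Un_disjoint finite_avoiding finite_UN_I) (auto simp: avoiding_def Z_def)
  also have "card (\<Union>e\<in>F. Z e) = (\<Sum>e\<in>F. card (Z e))"
    using finF finZ disj by (intro card_UN_disjoint) auto
  finally have "fact (card S) = real (card (avoiding S F)) + (\<Sum>e\<in>F. real (card (Z e)))"
    by (metis of_nat_add of_nat_fact of_nat_sum)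
  also have "(\<Sum>e\<in>F. real (card (Z e))) = card F * (fact (card S) / card S)"
    using Z by simp
  finally show ?thesis using N by (simp add: field_simps)
qed

text \<open>Composing with the transposition of u and w fixes both points and leaves a permutation
  of the others.\<close>

lemma card_permutations_swapping_le:
  assumes "finite S" "u \<in> S" "w \<in> S" "u \<noteq> w"
  shows "card {\<pi>. \<pi> permutes S \<and> \<pi> w = u \<and> \<pi> u = w} \<le> fact (card S - 2)"
proof -
  let ?R = "{\<rho>. \<rho> permutes (S - {u, w})}"
  have "{\<pi>. \<pi> permutes S \<and> \<pi> w = u \<and> \<pi> u = w} \<subseteq>
      (\<lambda>\<rho>. \<rho> \<circ> Transposition.transpose u w) ` ?R"
  proof (rule subsetI)
    fix \<pi> assume "\<pi> \<in> {\<pi>. \<pi> permutes S \<and> \<pi> w = u \<and> \<pi> u = w}"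
    then have p: "\<pi> permutes S" "\<pi> w = u" "\<pi> u = w" by auto
    have "\<pi> \<circ> Transposition.transpose u w permutes S"
      using p assms by (intro permutes_compose permutes_swap_id)
    then have "\<pi> \<circ> Transposition.transpose u w permutes (S - {u, w})"
      using p by (elim permutes_superset) auto
    moreover have "\<pi> = (\<pi> \<circ> Transposition.transpose u w) \<circ> Transposition.transpose u w"
      by (simp add: comp_assoc)
    ultimately show "\<pi> \<in> (\<lambda>\<rho>. \<rho> \<circ> Transposition.transpose u w) ` ?R" by blast
  qed
  then have "card {\<pi>. \<pi> permutes S \<and> \<pi> w = u \<and> \<pi> u = w} \<le> card ?R"
    using assms by (intro surj_card_le finite_permutations) auto
  also have "\<dots> = fact (card (S - {u, w}))"
    using assms by (intro card_permutations) auto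
  also have "card (S - {u, w}) = card S - 2" using assms by (simp add: card_Diff_subset)
  finally show ?thesis .
qed

text \<open>Fixed points in F are excluded one at a time through
  \<open>card_avoiding_le_through_edge\<close>, each exclusion keeping about the fraction
  \<open>1 - 1 / card S\<close>. The exceptional permutations of that bound interchange the new
  point with one treated before; they add at most \<open>1 / (card S * (card S - 1))\<close> per
  point.\<close>

lemma card_avoiding_diagonal_le:
  assumes fin: "finite S" and N: "2 \<le> card S" and F: "F \<subseteq> S"
  shows "real (card (avoiding S ((\<lambda>i. (i, i)) ` F))) / fact (card S) \<le>
    (1 - 1 / card S) ^ card F + card F / (real (card S) * (card S - 1))"
proof -
  let ?N = "real (card S)" and ?E = "\<lambda>F. (\<lambda>i. (i, i)) ` F"
  let ?g = "\<lambda>F. real (card (avoiding S (?E F))) / fact (card S)"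
  have "finite F" using F fin by (auto intro: finite_subset)
  then show ?thesis using F
  proof (induction F rule: finite_induct)
    case (insert u F)
    have uS: "u \<in> S" and FS: "F \<subseteq> S" using insert.prems by auto
    define B where "B = {\<pi>. \<pi> permutes S \<and> (\<exists>w. \<pi> w = u \<and> (w, \<pi> u) \<in> ?E F)}"
    have "B \<subseteq> (\<Union>w\<in>F. {\<pi>. \<pi> permutes S \<and> \<pi> w = u \<and> \<pi> u = w})"
      by (auto simp: B_def)
    then have "card B \<le> card (\<Union>w\<in>F. {\<pi>. \<pi> permutes S \<and> \<pi> w = u \<and> \<pi> u = w})"
      using insert.hyps
      by (intro card_mono finite_UN_I finite_subset[OF _ finite_permutations[OF fin]]) auto
    also have "\<dots> \<le> (\<Sum>w\<in>F. card {\<pi>. \<pi> permutes S \<and> \<pi> w = u \<and> \<pi> u = w})"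
      by (rule card_UN_le[OF insert.hyps(1)])
    also have "\<dots> \<le> (\<Sum>w\<in>F. fact (card S - 2))"
      using insert.hyps uS FS fin by (intro sum_mono card_permutations_swapping_le) auto
    also have "\<dots> = card F * fact (card S - 2)" by simp
    also have "\<dots> \<le> card S * fact (card S - 2)"
      using FS fin by (intro mult_right_mono card_mono) auto
    finally have "real (card B) \<le> real (card S * fact (card S - 2))"
      by (simp only: of_nat_le_iff)
    moreover have fact2: "fact (card S) = ?N * ((?N - 1) * fact (card S - 2))"
    proof -
      define j where "j = card S - 2"
      have j: "card S = Suc (Suc j)" using N by (simp add: j_def)
      show ?thesis unfolding j by simp
    qed
    ultimately have B: "real (card B) \<le> fact (card S) / (?N - 1)"
      using N by (subst fact2) simp
    define Z where "Z = {\<pi> \<in> avoiding S (?E F). \<pi> u = u}"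
    have split: "real (card (avoiding S (?E F))) =
        real (card (avoiding S (?E (insert u F)))) + real (card Z)"
      using card_avoiding_insert[OF fin, of "?E F" u u] by (simp add: Z_def)
    have "card (avoiding S (?E F)) \<le> card S * card Z + card B"
      unfolding Z_def B_def
      using insert.hyps uS by (intro card_avoiding_le_through_edge fin) auto
    then have "real (card (avoiding S (?E F))) \<le> ?N * real (card Z) + real (card B)"
      by (metis of_nat_add of_nat_le_iff of_nat_mult)
    then have "real (card (avoiding S (?E F))) - fact (card S) / (?N - 1) \<le> real (card Z) * ?N"
      using B by (simp add: mult.commute)
    then have "real (card Z) \<ge> (real (card (avoiding S (?E F))) - fact (card S) / (?N - 1)) / ?N"
      using N by (simp only: pos_divide_le_eq)
    then have "?g (insert u F) \<le>
        (real (card (avoiding S (?E F))) -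
          (real (card (avoiding S (?E F))) - fact (card S) / (?N - 1)) / ?N) / fact (card S)"
      using split by (intro divide_right_mono) auto
    also have "\<dots> = (1 - 1 / ?N) * ?g F + 1 / (?N * (?N - 1))"
      using N by (simp add: field_simps)
    also have "\<dots> \<le> (1 - 1 / ?N) * ((1 - 1 / ?N) ^ card F + card F / (?N * (card S - 1))) +
        1 / (?N * (?N - 1))"
      using insert.IH[OF FS] N by (intro add_right_mono mult_left_mono) auto
    also have "\<dots> \<le> (1 - 1 / ?N) ^ card (insert u F) +
        card (insert u F) / (?N * (card S - 1))"
    proof -
      have "(1 - 1 / ?N) * (card F / (?N * (card S - 1))) \<le> 1 * (card F / (?N * (card S - 1)))"
        using N by (intro mult_right_mono) auto
      then show ?thesis
        using insert.hyps N by (simp add: distrib_left add_divide_distrib of_nat_diff)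
    qed
    finally show ?case .
  qed (use card_avoiding_le_fact[OF fin, of "{}"] fin in simp)
qed

section \<open>Meeting probabilities of fixed schedules\<close>

text \<open>Pairs run from \<open>b t\<close> to \<open>a t\<close> because the players meet at step
  t when \<open>a t = \<pi> (b t)\<close>.\<close>

definition no_meeting_prob :: "'a set \<Rightarrow> 'b set \<Rightarrow> ('b \<Rightarrow> 'a) \<Rightarrow> ('b \<Rightarrow> 'a) \<Rightarrow> real" where
  "no_meeting_prob S I a b = card (avoiding S ((\<lambda>t. (b t, a t)) ` I)) / fact (card S)"

lemma no_meeting_prob_le_1: "finite S \<Longrightarrow> no_meeting_prob S I a b \<le> 1"
  using of_nat_mono[OF card_avoiding_le_fact, where 'a = real]
  by (simp add: no_meeting_prob_def divide_le_eq_1)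

text \<open>Against a constant schedule the forbidden pairs form a star, with \<open>card I\<close>
  distinct pairs by injectivity.\<close>

lemma no_meeting_prob_const_inj:
  assumes "finite S" "S \<noteq> {}" "inj_on a I" "a ` I \<subseteq> S" "c \<in> S"
  shows "no_meeting_prob S I a (\<lambda>_. c) = 1 - card I / card S"
    and "no_meeting_prob S I (\<lambda>_. c) a = 1 - card I / card S"
proof -
  have "card ((\<lambda>t. (c, a t)) ` I) = card I" "card ((\<lambda>t. (a t, c)) ` I) = card I"
    using assms(3) by (auto intro!: card_image simp: inj_on_def)
  then show "no_meeting_prob S I a (\<lambda>_. c) = 1 - card I / card S"
    "no_meeting_prob S I (\<lambda>_. c) a = 1 - card I / card S"
    unfolding no_meeting_prob_def using assms
    by (subst card_avoiding_star; force)+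
qed

text \<open>Both players follow the same schedule, so all forbidden pairs lie on the
  diagonal.\<close>

lemma no_meeting_prob_inj_le:
  assumes "finite S" "2 \<le> card S" "inj_on a I" "a ` I \<subseteq> S"
  shows "no_meeting_prob S I a a \<le> exp (- (card I / card S)) + 1 / (real (card S) - 1)"
proof -
  let ?N = "real (card S)"
  have I: "card (a ` I) = card I" using assms(3) by (rule card_image)
  then have IN: "real (card I) \<le> ?N" using card_mono[OF assms(1,4)] by simp
  have "no_meeting_prob S I a a \<le> (1 - 1 / ?N) ^ card I + card I / (?N * (card S - 1))"
    using card_avoiding_diagonal_le[OF assms(1,2,4)] unfolding I
    by (simp add: no_meeting_prob_def image_image)
  also have "(1 - 1 / ?N) ^ card I \<le> exp (- 1 / ?N) ^ card I"
    using assms exp_ge_add_one_self[of "- 1 / ?N"] by (intro power_mono) auto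
  also have "\<dots> = exp (- (card I / ?N))" by (simp flip: exp_of_nat_mult)
  also have "card I / (?N * (card S - 1)) \<le> 1 / (?N - 1)"
  proof -
    have "card I / (?N * (card S - 1)) \<le> ?N / (?N * (card S - 1))"
      using IN by (intro divide_right_mono) auto
    then show ?thesis using assms(2) by (simp add: of_nat_diff split: if_splits)
  qed
  finally show ?thesis by simp
qed

section \<open>Heavy steps and the lower bound for two fixed schedules\<close>

text \<open>Heaviness is attached to steps rather than labels: the labels of the two players are
  unrelated, while their steps can be compared.\<close>

definition heavy :: "nat \<Rightarrow> 'b set \<Rightarrow> ('b \<Rightarrow> 'a) \<Rightarrow> 'b set" where
  "heavy k I a = {t \<in> I. k < card {t' \<in> I. a t' = a t}}"

text \<open>Each heavy label takes more than k steps. For large k there are few heavy labels, which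
  makes forbidden pairs of two heavy labels negligible.\<close>

lemma card_heavy_values_le:
  assumes "finite I"
  shows "card (a ` heavy k I a) * k \<le> card I"
proof -
  let ?V = "a ` heavy k I a"
  have finV: "finite ?V" using assms by (simp add: heavy_def)
  have "card ?V * k = (\<Sum>v\<in>?V. k)" by simp
  also have "\<dots> \<le> (\<Sum>v\<in>?V. card {t \<in> I. a t = v})"
    by (intro sum_mono) (auto simp: heavy_def)
  also have "\<dots> = card (\<Union>v\<in>?V. {t \<in> I. a t = v})"
    using assms finV by (intro card_UN_disjoint[symmetric]) auto
  also have "\<dots> \<le> card I" using assms by (intro card_mono) auto
  finally show ?thesis .
qed

lemma heavy_iff: "t \<in> I \<Longrightarrow> a t \<in> a ` heavy k I a \<longleftrightarrow> t \<in> heavy k I a"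
  by (auto simp: heavy_def)

lemma card_light_le:
  assumes "v \<notin> a ` heavy k I a"
  shows "card {t \<in> I. a t = v} \<le> k"
proof (cases "\<exists>t\<in>I. a t = v")
  case True
  then obtain t where t: "t \<in> I" "a t = v" by blast
  then have "t \<notin> heavy k I a" using assms by blast
  then show ?thesis using t by (auto simp: heavy_def)
next
  case False
  then have "{t \<in> I. a t = v} = {}" by auto
  then show ?thesis by (metis card.empty zero_le)
qed

text \<open>With \<open>y = N - 2 * k - 1\<close> the base is \<open>1 - 1 / (y + 1)\<close>, which
  is at least \<open>exp (- (1 / y))\<close>. The exponent \<open>L / y\<close> is at most
  \<open>l * r\<close> with \<open>r = N / y\<close>, and replacing \<open>l * r\<close> by l costs
  at most \<open>r - 1\<close> because \<open>l \<le> 1\<close>.\<close>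

lemma one_minus_inverse_power_ge:
  fixes N k :: real
  assumes k: "0 \<le> k" "2 * k + 1 < N" and L: "real L \<le> l * N" and l: "l \<le> 1"
  shows "exp (- l) - (N / (N - 2 * k - 1) - 1) \<le> (1 - 1 / (N - 2 * k)) ^ L"
proof -
  define y where "y = N - 2 * k - 1"
  have y: "y > 0" "N \<ge> y" using k by (auto simp: y_def)
  define r where "r = N / y"
  have r: "r \<ge> 1" using y by (simp add: r_def)
  have l0: "0 \<le> l"
    using L k by (smt (verit) mult_neg_pos of_nat_0_le_iff)
  have "exp (- (1 / y)) \<le> 1 - 1 / (y + 1)"
  proof -
    have "1 + 1 / y \<le> exp (1 / y)" by (rule exp_ge_add_one_self)
    then have "inverse (exp (1 / y)) \<le> inverse (1 + 1 / y)"
      using y by (intro le_imp_inverse_le) (auto simp: add_pos_pos)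
    also have "inverse (1 + 1 / y) = 1 - 1 / (y + 1)" using y by (simp add: field_simps)
    finally show ?thesis by (simp add: exp_minus)
  qed
  then have "exp (- (1 / y)) ^ L \<le> (1 - 1 / (y + 1)) ^ L" by (intro power_mono) auto
  moreover have "exp (- (1 / y)) ^ L = exp (- (L / y))" by (simp flip: exp_of_nat_mult)
  moreover have "exp (- (l * r)) \<le> exp (- (L / y))"
    using L y by (simp add: r_def divide_right_mono)
  moreover have "exp (- l) - (r - 1) \<le> exp (- (l * r))"
  proof -
    have e: "1 - l * (r - 1) \<le> exp (- (l * (r - 1)))"
      using exp_ge_add_one_self[of "- (l * (r - 1))"] by simp
    have "l * (r - 1) \<le> 1 * (r - 1)" using l r by (intro mult_right_mono) auto
    then have "exp (- l) - (r - 1) \<le> exp (- l) - l * (r - 1)" by simp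
    also have "\<dots> \<le> exp (- l) - exp (- l) * (l * (r - 1))"
      using l0 r mult_right_mono[of "exp (- l)" 1 "l * (r - 1)"] by simp
    also have "\<dots> = exp (- l) * (1 - l * (r - 1))" by (simp add: algebra_simps)
    also have "\<dots> \<le> exp (- l) * exp (- (l * (r - 1)))" using e by (intro mult_left_mono) auto
    also have "\<dots> = exp (- (l * r))" by (simp flip: exp_add add: algebra_simps)
    finally show ?thesis .
  qed
  moreover have y1: "N - 2 * k = y + 1" by (simp add: y_def)
  ultimately show ?thesis unfolding y_def[symmetric] r_def[symmetric] unfolding y1 by linarith
qed

text \<open>\<open>card_avoiding_ge\<close> is applied with U the heavy labels of b and V those of
  a. The error \<open>N / k\<^sup>2\<close> arises since each player has at most
  \<open>N / k\<close> heavy labels; the rest of the error is the cost in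
  \<open>one_minus_inverse_power_ge\<close>.\<close>

lemma no_meeting_prob_ge:
  assumes fin: "finite S" "finite I" and ab: "a ` I \<subseteq> S" "b ` I \<subseteq> S"
    and I: "card I \<le> card S" and k: "0 < k" "2 * k + 1 < card S"
  defines "N \<equiv> real (card S)" and "A \<equiv> heavy k I a" and "B \<equiv> heavy k I b"
  shows "(1 - card (B - A) / N) * (1 - card (A - B) / N) * exp (- (card (I - A - B) / N)) -
    (N / k\<^sup>2 + (N / (N - 2 * k - 1) - 1)) \<le> no_meeting_prob S I a b"
proof -
  let ?e = "\<lambda>t. (b t, a t)"
  define E where "E = ?e ` I"
  define U where "U = b ` B"
  define V where "V = a ` A"
  have N0: "N > 0" using k by (simp add: N_def)
  have AB: "A \<subseteq> I" "B \<subseteq> I" by (auto simp: A_def B_def heavy_def)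
  have finAB: "finite A" "finite B" using AB fin by (auto intro: finite_subset)
  have memV: "a t \<in> V \<longleftrightarrow> t \<in> A" and memU: "b t \<in> U \<longleftrightarrow> t \<in> B" if "t \<in> I" for t
    using heavy_iff[OF that, of a k] heavy_iff[OF that, of b k]
    by (simp_all add: U_def V_def A_def B_def)
  have parts: "E \<inter> U \<times> (- V) = ?e ` (B - A)" "E \<inter> (- U) \<times> V = ?e ` (A - B)"
    "E \<inter> (- U) \<times> (- V) = ?e ` (I - A - B)"
    using memU memV AB by (auto simp: E_def)
  \<comment> \<open>Several steps may give the same pair, so step counts only bound pair counts from
    above; fewer pairs only improve the lower bound.\<close>
  have HL: "card (E \<inter> U \<times> (- V)) \<le> card (B - A)"
    and LH: "card (E \<inter> (- U) \<times> V) \<le> card (A - B)"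
    and LL: "card (E \<inter> (- U) \<times> (- V)) \<le> card (I - A - B)"
    unfolding parts using fin finAB by (auto intro: card_image_le)
  have le: "card (B - A) \<le> card S" "card (A - B) \<le> card S" "card (I - A - B) \<le> card S"
    using AB fin I by (auto intro!: order_trans[OF card_mono I])
  have degU: "card (E `` {u}) \<le> k" if "u \<in> S - U" for u
  proof -
    have "E `` {u} = a ` {t \<in> I. b t = u}" by (auto simp: E_def)
    then have "card (E `` {u}) \<le> card {t \<in> I. b t = u}" using fin by (simp add: card_image_le)
    also have "\<dots> \<le> k" using that by (intro card_light_le) (simp add: U_def B_def)
    finally show ?thesis .
  qed
  have degV: "card (E\<inverse> `` {v}) \<le> k" if "v \<in> S - V" for v
  proof -
    have "E\<inverse> `` {v} = b ` {t \<in> I. a t = v}" by (auto simp: E_def)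
    then have "card (E\<inverse> `` {v}) \<le> card {t \<in> I. a t = v}" using fin by (simp add: card_image_le)
    also have "\<dots> \<le> k" using that by (intro card_light_le) (simp add: V_def A_def)
    finally show ?thesis .
  qed
  let ?q = "(1 - 1 / (N - 2 * k)) ^ card (E \<inter> (- U) \<times> (- V))"
  have "real (card (avoiding S E)) / fact (card S) \<ge>
    (1 - card (E \<inter> U \<times> (- V)) / N) * (1 - card (E \<inter> (- U) \<times> V) / N) * ?q -
      card U * card V / N"
  proof -
    have "E \<subseteq> S \<times> S" using ab by (auto simp: E_def)
    moreover have "finite U" "finite V" using finAB by (auto simp: U_def V_def)
    moreover have "2 * k < card S" using k by simp
    ultimately show ?thesis
      using card_avoiding_ge[OF fin(1) _ degU degV] order_trans[OF HL le(1)]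
        order_trans[OF LH le(2)]
      by (simp add: N_def)
  qed
  moreover have "card U * card V / N \<le> N / k\<^sup>2"
  proof -
    have "card U * k \<le> card S" "card V * k \<le> card S"
      using card_heavy_values_le[OF fin(2)] I by (auto simp: U_def V_def A_def B_def intro: order_trans)
    then have "(card U * k) * (card V * k) \<le> card S * card S" by (intro mult_mono) auto
    then have "real ((card U * k) * (card V * k)) \<le> real (card S * card S)"
      by (simp only: of_nat_le_iff)
    then have "real (card U * card V) * k\<^sup>2 \<le> N * N"
      by (simp add: N_def power2_eq_square algebra_simps)
    then show ?thesis using N0 k by (simp add: field_simps)
  qed
  moreover have "(1 - card (B - A) / N) * (1 - card (A - B) / N) * exp (- (card (I - A - B) / N)) -
      (N / (N - 2 * k - 1) - 1) \<le>
      (1 - card (E \<inter> U \<times> (- V)) / N) * (1 - card (E \<inter> (- U) \<times> V) / N) * ?q"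
  proof -
    \<comment> \<open>Since c is at most 1, multiplying by it does not enlarge the error \<rho> of
      the exponential factor.\<close>
    define c where "c = (1 - card (B - A) / N) * (1 - card (A - B) / N)"
    have c: "0 \<le> c" "c \<le> 1" using le N0 unfolding c_def
      by (auto intro!: mult_le_one mult_nonneg_nonneg simp: N_def)
    have k': "2 * real k + 1 < N" using k by (simp add: N_def)
    define \<rho> where "\<rho> = N / (N - 2 * k - 1) - 1"
    have "exp (- (card (I - A - B) / N)) - \<rho> \<le> ?q"
      using one_minus_inverse_power_ge[of "real k" N "card (E \<inter> (- U) \<times> (- V))"
          "card (I - A - B) / N"] N0 k' LL le
      by (simp add: N_def \<rho>_def)
    then have "c * (exp (- (card (I - A - B) / N)) - \<rho>) \<le> c * ?q"
      using c by (intro mult_left_mono)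
    then have "c * exp (- (card (I - A - B) / N)) - c * \<rho> \<le> c * ?q"
      by (simp only: right_diff_distrib)
    moreover have "c * \<rho> \<le> 1 * \<rho>"
      using c k' by (intro mult_right_mono) (auto simp: field_simps \<rho>_def)
    moreover have "c * ?q \<le>
        (1 - card (E \<inter> U \<times> (- V)) / N) * (1 - card (E \<inter> (- U) \<times> V) / N) * ?q"
      unfolding c_def using HL LH le N0 k'
      by (intro mult_right_mono mult_mono zero_le_power)
        (auto simp: N_def divide_right_mono field_simps)
    ultimately show ?thesis unfolding c_def[symmetric] \<rho>_def[symmetric] by linarith
  qed
  ultimately show ?thesis by (simp add: no_meeting_prob_def E_def)
qed

section \<open>Averaging over schedules\<close>

text \<open>\<open>(1 - u) * exp u\<close> has second derivative \<open>- (1 + u) * exp u\<close>,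
  so it is concave on \<open>{0..s}\<close> and lies above its chord. This serves the end
  \<open>\<eta> = 0\<close> of \<open>meeting_interpolation\<close>.\<close>

lemma chord_one_minus_times_exp:
  fixes s \<sigma> :: real
  assumes "0 \<le> \<sigma>" "\<sigma> \<le> s" "s > 0"
  shows "s * ((1 - \<sigma>) * exp \<sigma>) \<ge> (s - \<sigma>) + \<sigma> * ((1 - s) * exp s)"
proof -
  have "convex_on {0..s} (\<lambda>u. - ((1 - u) * exp u))"
  proof (rule f''_ge0_imp_convex)
    show "((\<lambda>u. - ((1 - u) * exp u)) has_real_derivative x * exp x) (at x)" for x :: real
      by (auto intro!: derivative_eq_intros simp: algebra_simps)
    show "((\<lambda>u. u * exp u) has_real_derivative (1 + x) * exp x) (at x)" for x :: real
      by (auto intro!: derivative_eq_intros simp: algebra_simps)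
  qed auto
  from convex_onD[OF this, of "\<sigma> / s" 0 s]
  have "- ((1 - \<sigma>) * exp \<sigma>) \<le> - (1 - \<sigma> / s) - \<sigma> / s * ((1 - s) * exp s)"
    using assms by simp
  then have "s * ((1 - \<sigma> / s) + \<sigma> / s * ((1 - s) * exp s)) \<le> s * ((1 - \<sigma>) * exp \<sigma>)"
    using assms by (intro mult_left_mono) auto
  moreover have "s * ((1 - \<sigma> / s) + \<sigma> / s * ((1 - s) * exp s)) =
      (s - \<sigma>) + \<sigma> * ((1 - s) * exp s)"
    using assms by (simp add: field_simps)
  ultimately show ?thesis by simp
qed

text \<open>After division by s: the chord of \<open>exp\<close> over \<open>{0..s}\<close> exceeds
  \<open>exp w\<close> by at most \<open>w * (s - w)\<close>. The second-derivative estimate would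
  give the factor \<open>exp s / 2\<close>, which is above 1 once \<open>s > ln 2\<close>; hence the
  split at \<open>ln 2\<close>. This serves the end \<open>\<mu> = \<nu> = 0\<close> of
  \<open>meeting_interpolation\<close>.\<close>

lemma exp_chord_gap:
  fixes s w :: real
  assumes w: "0 \<le> w" "w \<le> s" and s: "s \<le> 1"
  shows "s * exp w - s * exp s + (s - w) * (exp s - 1) + s * (s - w) * w \<ge> 0"
proof (cases "s = 0")
  case False
  then have s0: "s > 0" using w by simp
  define p where "p w = s * exp w - s * exp s + (s - w) * (exp s - 1) + s * (s - w) * w" for w
  define p' where "p' w = s * exp w - (exp s - 1) + s * s - 2 * s * w" for w
  define p'' where "p'' w = s * exp w - 2 * s" for w
  have d1: "(p has_real_derivative p' x) (at x)" for x
    unfolding p_def p'_def by (auto intro!: derivative_eq_intros simp: algebra_simps)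
  have d2: "(p' has_real_derivative p'' x) (at x)" for x
    unfolding p'_def p''_def by (auto intro!: derivative_eq_intros simp: algebra_simps)
  have ps: "p s = 0" and p0: "p 0 = 0" by (simp_all add: p_def algebra_simps)
  have "p' s = - ((1 - s) * (exp s - 1 - s))" by (simp add: p'_def algebra_simps)
  moreover have "(1 - s) * (exp s - 1 - s) \<ge> 0"
    using s exp_ge_add_one_self[of s] by (intro mult_nonneg_nonneg) linarith+
  ultimately have p's: "p' s \<le> 0" by linarith
  \<comment> \<open>Beyond \<open>ln 2\<close> the function p is convex, and
    \<open>p' s \<le> 0\<close>, so it decreases to \<open>p s = 0\<close>.\<close>
  have right: "p x \<ge> 0" if x: "ln 2 \<le> x" "x \<le> s" for x
  proof -
    have neg: "p' y \<le> 0" if y: "x \<le> y" "y \<le> s" for y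
    proof -
      have "p' y \<le> p' s"
      proof (rule DERIV_nonneg_imp_nondecreasing[OF y(2)])
        fix z assume z: "y \<le> z" "z \<le> s"
        have "exp (ln 2) \<le> exp z" using z y x by (simp only: exp_le_cancel_iff)
        then have "2 \<le> exp z" by simp
        then have "p'' z \<ge> 0" using s0 by (simp add: p''_def)
        then show "\<exists>d. (p' has_real_derivative d) (at z) \<and> 0 \<le> d" using d2 by blast
      qed
      then show ?thesis using p's by simp
    qed
    have "p s \<le> p x"
      by (rule DERIV_nonpos_imp_nonincreasing[OF x(2)]) (use d1 neg in blast)
    then show ?thesis using ps by simp
  qed
  have "p w \<ge> 0"
  proof (cases "ln 2 \<le> w")
    case True then show ?thesis using right w by simp
  next
    case False
    \<comment> \<open>On \<open>{0..e}\<close> the function p is concave and nonnegative at both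
      ends.\<close>
    define e where "e = min s (ln 2)"
    have e: "w \<le> e" "0 < e" "0 \<le> p e"
      using False w s0 ps right[of "ln 2"] by (auto simp: e_def min_def)
    have "convex_on {0..e} (\<lambda>x. - p x)"
    proof (rule f''_ge0_imp_convex)
      show "((\<lambda>x. - p x) has_real_derivative - p' x) (at x)" for x
        by (intro DERIV_minus d1)
      show "((\<lambda>x. - p' x) has_real_derivative - p'' x) (at x)" for x
        by (intro DERIV_minus d2)
      fix x assume "x \<in> {0..e}"
      then have "x \<le> ln 2" by (simp add: e_def)
      then have "exp x \<le> exp (ln 2)" by (simp only: exp_le_cancel_iff)
      then have "exp x \<le> 2" by simp
      then show "- p'' x \<ge> 0" using s0 by (simp add: p''_def)
    qed auto
    from convex_onD[OF this, of "w / e" 0 e]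
    have "- p w \<le> - (w / e * p e)" using e w p0 by simp
    moreover have "w / e * p e \<ge> 0" using e w by simp
    ultimately show ?thesis by linarith
  qed
  then show ?thesis by (simp add: p_def)
qed (use w in simp)

text \<open>At the four corners of the simplex the left-hand side agrees with the right-hand side,
  and the first summand on the left interpolates linearly between these values. The correction
  \<open>\<mu> * \<nu> - \<eta> * l\<close> vanishes there; it makes up for the convexity of \<open>exp\<close>.\<close>

lemma meeting_interpolation:
  fixes \<mu> \<nu> l \<eta> s :: real
  assumes nn: "0 \<le> \<mu>" "0 \<le> \<nu>" "0 \<le> l" "0 \<le> \<eta>" and s: "s = \<mu> + \<nu> + l + \<eta>" "0 < s" "s \<le> 1"
  shows "(l * exp (- s) + (\<mu> + \<nu>) * (1 - s) + \<eta>) / s + exp (- s) * (\<mu> * \<nu> - \<eta> * l)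
    \<le> (1 - \<mu>) * (1 - \<nu>) * exp (- l)"
proof -
  define \<sigma> where "\<sigma> = \<mu> + \<nu>"
  \<comment> \<open>\<open>G z\<close> is \<open>s * exp s\<close> times the difference of the two
    sides for \<open>\<mu> + \<nu> = z\<close>, with the \<open>\<mu> * \<nu>\<close> terms left
    out. For fixed s and l it is affine in z, so its ends \<open>z = 0\<close> and
    \<open>z = s - l\<close> decide.\<close>
  define G where
    "G z = s * (1 - z) * exp (s - l) - l - (s * (1 - z) - l) * exp s + s * l * (s - z - l)" for z
  have G0: "G 0 \<ge> 0"
    using exp_chord_gap[of "s - l" s] nn s by (simp add: G_def algebra_simps)
  have G1: "G (s - l) \<ge> 0"
    using chord_one_minus_times_exp[of "s - l" s] nn s by (simp add: G_def algebra_simps)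
  have \<sigma>: "0 \<le> \<sigma>" "\<sigma> \<le> s - l" using nn s by (auto simp: \<sigma>_def)
  have "G \<sigma> \<ge> 0"
  proof (cases "s = l")
    case True then show ?thesis using \<sigma> G0 by simp
  next
    case False
    then have sl: "s - l > 0" using \<sigma> by linarith
    have "(s - l) * G \<sigma> = (s - l - \<sigma>) * G 0 + \<sigma> * G (s - l)"
      unfolding G_def by (simp add: algebra_simps)
    also have "\<dots> \<ge> 0" using \<sigma> G0 G1 by (intro add_nonneg_nonneg mult_nonneg_nonneg) auto
    finally show ?thesis using sl by (simp add: zero_le_mult_iff)
  qed
  then have "G \<sigma> * exp (- s) / s \<ge> 0" using s by simp
  moreover have "G \<sigma> * exp (- s) / s = (1 - \<sigma>) * exp (- l) -
      ((l * exp (- s) + \<sigma> * (1 - s) + \<eta>) / s - exp (- s) * (\<eta> * l))"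
  proof -
    have e: "exp (s - l) * exp (- s) = exp (- l)" "exp s * exp (- s) = 1"
      by (simp_all flip: exp_add)
    have \<eta>: "\<eta> = s - \<sigma> - l" using s by (simp add: \<sigma>_def)
    have "G \<sigma> * exp (- s) = s * (1 - \<sigma>) * (exp (s - l) * exp (- s)) - l * exp (- s) -
        (s * (1 - \<sigma>) - l) * (exp s * exp (- s)) + s * l * (s - \<sigma> - l) * exp (- s)"
      by (simp add: G_def algebra_simps)
    then show ?thesis unfolding e using s(2) by (simp add: \<eta> field_simps)
  qed
  \<comment> \<open>The \<open>\<mu> * \<nu>\<close> terms left out of G compare separately, as
    \<open>l \<le> s\<close>.\<close>
  moreover have "\<mu> * \<nu> * exp (- l) \<ge> \<mu> * \<nu> * exp (- s)"
    using nn s by (intro mult_left_mono) auto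
  moreover have "(1 - \<mu>) * (1 - \<nu>) * exp (- l) = (1 - \<sigma>) * exp (- l) + \<mu> * \<nu> * exp (- l)"
    by (simp add: \<sigma>_def algebra_simps)
  moreover have "exp (- s) * (\<mu> * \<nu> - \<eta> * l) = \<mu> * \<nu> * exp (- s) - exp (- s) * (\<eta> * l)"
    by (simp add: algebra_simps)
  ultimately show ?thesis unfolding \<sigma>_def by linarith
qed

text \<open>\<open>meeting_interpolation\<close> is a polynomial in the fractions
  \<open>x a\<close>, \<open>x b\<close> and the overlap \<open>g a b\<close>. Averaging over
  independent a and b leaves the mean overlap as the only quantity not determined by p, and its
  coefficient is nonnegative, so a lower bound on it suffices.\<close>

lemma average_meeting_ge:
  fixes w :: "'c \<Rightarrow> real" and H :: "'c \<Rightarrow> 'b set" and N :: real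
  assumes fin: "finite C" "finite I" "I \<noteq> {}" and H: "\<And>a. a \<in> C \<Longrightarrow> H a \<subseteq> I"
    and w: "\<And>a. a \<in> C \<Longrightarrow> 0 \<le> w a" "(\<Sum>a\<in>C. w a) = 1"
    and N: "card I \<le> N"
  defines "s \<equiv> card I / N" and "p \<equiv> \<Sum>a\<in>C. w a * (card (H a) / card I)"
  shows "p\<^sup>2 + 2 * p * (1 - p) * (1 - s) + (1 - p)\<^sup>2 * exp (- s) \<le>
    (\<Sum>a\<in>C. \<Sum>b\<in>C. w a * w b *
      ((1 - card (H b - H a) / N) * (1 - card (H a - H b) / N) *
        exp (- (card (I - H a - H b) / N))))"
proof -
  let ?m = "real (card I)"
  define x where "x a = card (H a) / ?m" for a
  define g where "g a b = card (H a \<inter> H b) / ?m" for a b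
  define c where "c = exp (- s)"
  have m: "?m > 0" using fin by (simp add: card_gt_0_iff)
  have s: "0 < s" "s \<le> 1" using m N by (auto simp: s_def)
  have N0: "N > 0" using m N by simp
  have finH: "finite (H a)" if "a \<in> C" for a using H[OF that] fin(2) by (rule finite_subset)
  have pt: "c + (x a + x b) * (1 - s - c) + g a b * (c - 1 + 2 * s - c * s\<^sup>2) +
        c * s\<^sup>2 * (x a * x b) \<le>
      (1 - card (H b - H a) / N) * (1 - card (H a - H b) / N) *
        exp (- (card (I - H a - H b) / N))" if ab: "a \<in> C" "b \<in> C" for a b
  proof -
    define \<mu> where "\<mu> = card (H b - H a) / N"
    define \<nu> where "\<nu> = card (H a - H b) / N"
    define \<eta> where "\<eta> = card (H a \<inter> H b) / N"
    define l where "l = card (I - H a - H b) / N"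
    have ca: "real (card (H a)) = card (H a - H b) + card (H a \<inter> H b)"
      using card_Int_Diff[OF finH[OF ab(1)], of "H b"] by simp
    have cb: "real (card (H b)) = card (H b - H a) + card (H a \<inter> H b)"
      using card_Int_Diff[OF finH[OF ab(2)], of "H a"] by (simp add: Int_commute)
    have "card I = card (H a) + card (I - H a)"
      using card_Diff_subset[OF finH[OF ab(1)] H[OF ab(1)]] card_mono[OF fin(2) H[OF ab(1)]] by simp
    moreover have "card (I - H a) = card ((I - H a) \<inter> H b) + card (I - H a - H b)"
      using fin by (intro card_Int_Diff) auto
    moreover have "(I - H a) \<inter> H b = H b - H a" using H[OF ab(2)] by auto
    ultimately have cI: "?m = card (H a) + card (H b - H a) + card (I - H a - H b)" by simp
    have xg: "\<eta> = s * g a b" "\<mu> = s * (x b - g a b)" "\<nu> = s * (x a - g a b)"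
      "l = s * (1 - x a - x b + g a b)"
    proof -
      have sx: "s * (real z / ?m) = real z / N" for z using m by (simp add: s_def)
      show "\<eta> = s * g a b" "\<mu> = s * (x b - g a b)" "\<nu> = s * (x a - g a b)"
        "l = s * (1 - x a - x b + g a b)"
        unfolding right_diff_distrib distrib_left x_def g_def sx mult_1_right
        by (simp_all add: \<eta>_def \<mu>_def \<nu>_def l_def s_def ca cb cI add_divide_distrib)
    qed
    have "(l * exp (- s) + (\<mu> + \<nu>) * (1 - s) + \<eta>) / s + exp (- s) * (\<mu> * \<nu> - \<eta> * l)
      \<le> (1 - \<mu>) * (1 - \<nu>) * exp (- l)"
    proof (rule meeting_interpolation)
      show "s = \<mu> + \<nu> + l + \<eta>" unfolding xg by (simp add: algebra_simps)
    qed (use N0 s in \<open>auto simp: \<mu>_def \<nu>_def \<eta>_def l_def\<close>)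
    moreover have "(l * exp (- s) + (\<mu> + \<nu>) * (1 - s) + \<eta>) / s + exp (- s) * (\<mu> * \<nu> - \<eta> * l) =
      c + (x a + x b) * (1 - s - c) + g a b * (c - 1 + 2 * s - c * s\<^sup>2) +
        c * s\<^sup>2 * (x a * x b)"
      unfolding xg c_def using s by (simp add: field_simps power2_eq_square)
    ultimately show ?thesis by (simp add: \<mu>_def \<nu>_def l_def)
  qed
  \<comment> \<open>\<Gamma> is the mean overlap of two independent heavy sets and
    \<open>P t\<close> the probability that step t is heavy; by independence \<Gamma> is the average
    of the squares of \<open>P t\<close>.\<close>
  define \<Gamma> where "\<Gamma> = (\<Sum>a\<in>C. \<Sum>b\<in>C. w a * w b * g a b)"
  define P where "P t = (\<Sum>a\<in>C. w a * of_bool (t \<in> H a))" for t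
  have sum_of_bool: "(\<Sum>t\<in>I. of_bool (t \<in> X)) = real (card (I \<inter> X))" for X
    using fin by simp
  have p: "p = (\<Sum>t\<in>I. P t) / ?m"
  proof -
    have "real (card (H a)) = (\<Sum>t\<in>I. of_bool (t \<in> H a))" if "a \<in> C" for a
      using Int_absorb1[OF H[OF that]] sum_of_bool[of "H a"] by simp
    then have "p = (\<Sum>a\<in>C. \<Sum>t\<in>I. w a * of_bool (t \<in> H a)) / ?m"
      by (simp add: p_def sum_divide_distrib sum_distrib_left)
    also have "(\<Sum>a\<in>C. \<Sum>t\<in>I. w a * of_bool (t \<in> H a)) = (\<Sum>t\<in>I. P t)"
      unfolding P_def by (rule sum.swap)
    finally show ?thesis .
  qed
  have \<Gamma>: "\<Gamma> = (\<Sum>t\<in>I. (P t)\<^sup>2) / ?m"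
  proof -
    have "real (card (H a \<inter> H b)) = (\<Sum>t\<in>I. of_bool (t \<in> H a) * of_bool (t \<in> H b))"
      if "a \<in> C" "b \<in> C" for a b
    proof -
      have "(\<Sum>t\<in>I. of_bool (t \<in> H a) * of_bool (t \<in> H b)) =
          (\<Sum>t\<in>I. of_bool (t \<in> H a \<inter> H b) :: real)"
        by (intro sum.cong) auto
      also have "\<dots> = card (I \<inter> (H a \<inter> H b))" by (rule sum_of_bool)
      also have "I \<inter> (H a \<inter> H b) = H a \<inter> H b" using H[OF that(1)] by auto
      finally show ?thesis by simp
    qed
    then have "\<Gamma> = (\<Sum>a\<in>C. \<Sum>b\<in>C. \<Sum>t\<in>I.
        (w a * of_bool (t \<in> H a)) * (w b * of_bool (t \<in> H b))) / ?m"
      unfolding \<Gamma>_def g_def sum_divide_distrib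
      by (intro sum.cong refl) (simp add: sum_distrib_left sum_divide_distrib mult_ac)
    also have "(\<Sum>a\<in>C. \<Sum>b\<in>C. \<Sum>t\<in>I. (w a * of_bool (t \<in> H a)) * (w b * of_bool (t \<in> H b))) =
        (\<Sum>a\<in>C. \<Sum>t\<in>I. \<Sum>b\<in>C. (w a * of_bool (t \<in> H a)) * (w b * of_bool (t \<in> H b)))"
      by (intro sum.cong refl sum.swap)
    also have "\<dots> = (\<Sum>t\<in>I. \<Sum>a\<in>C. \<Sum>b\<in>C. (w a * of_bool (t \<in> H a)) * (w b * of_bool (t \<in> H b)))"
      by (rule sum.swap)
    also have "\<dots> = (\<Sum>t\<in>I. (P t)\<^sup>2)"
      by (simp only: P_def power2_eq_square sum_product)
    finally show ?thesis .
  qed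
  have "p\<^sup>2 \<le> \<Gamma>"
  proof -
    have "(\<Sum>t\<in>I. 1 * P t)\<^sup>2 \<le> (\<Sum>t\<in>I. 1\<^sup>2) * (\<Sum>t\<in>I. (P t)\<^sup>2)"
      by (rule Cauchy_Schwarz_ineq_sum)
    then have "(\<Sum>t\<in>I. P t)\<^sup>2 \<le> ?m * (\<Sum>t\<in>I. (P t)\<^sup>2)" by simp
    then have "(\<Sum>t\<in>I. P t)\<^sup>2 / (?m * ?m) \<le> ?m * (\<Sum>t\<in>I. (P t)\<^sup>2) / (?m * ?m)"
      by (intro divide_right_mono) auto
    then show ?thesis unfolding p \<Gamma> using m by (simp add: power2_eq_square)
  qed
  \<comment> \<open>Inserting \<open>c \<ge> 1 - s\<close> leaves
    \<open>s * (1 - s) + s * s\<^sup>2\<close>.\<close>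
  moreover have "0 \<le> c - 1 + 2 * s - c * s\<^sup>2"
  proof -
    have "1 - s \<le> c" using exp_ge_add_one_self[of "- s"] by (simp add: c_def)
    then have "(1 - s) * (1 - s\<^sup>2) \<le> c * (1 - s\<^sup>2)"
      using s by (intro mult_right_mono) (auto simp: power_le_one)
    moreover have "0 \<le> s * (1 - s) + s * s\<^sup>2" using s by simp
    ultimately show ?thesis by (simp add: algebra_simps power2_eq_square)
  qed
  ultimately have "(c - 1 + 2 * s - c * s\<^sup>2) * p\<^sup>2 \<le> (c - 1 + 2 * s - c * s\<^sup>2) * \<Gamma>"
    by (rule mult_left_mono)
  \<comment> \<open>At \<open>\<Gamma> = p\<^sup>2\<close> the terms with
    \<open>c * s\<^sup>2\<close> cancel and both sides agree.\<close>
  then have "p\<^sup>2 + 2 * p * (1 - p) * (1 - s) + (1 - p)\<^sup>2 * c \<le>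
      c + 2 * p * (1 - s - c) + \<Gamma> * (c - 1 + 2 * s - c * s\<^sup>2) + c * s\<^sup>2 * p\<^sup>2"
    by (simp add: algebra_simps power2_eq_square)
  also have "\<dots> = (\<Sum>a\<in>C. \<Sum>b\<in>C. w a * w b * (c + (x a + x b) * (1 - s - c) +
      g a b * (c - 1 + 2 * s - c * s\<^sup>2) + c * s\<^sup>2 * (x a * x b)))"
  proof -
    define d where "d = 1 - s - c"
    define e where "e = c - 1 + 2 * s - c * s\<^sup>2"
    have px: "(\<Sum>a\<in>C. w a * x a) = p" by (simp add: p_def x_def)
    have "(\<Sum>a\<in>C. \<Sum>b\<in>C. w a * w b * (c + (x a + x b) * d + g a b * e + c * s\<^sup>2 * (x a * x b))) =
      (\<Sum>a\<in>C. \<Sum>b\<in>C. c * (w a * w b) + d * ((w a * x a) * w b) + d * (w a * (w b * x b)) +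
        e * (w a * w b * g a b) + c * s\<^sup>2 * ((w a * x a) * (w b * x b)))"
      by (intro sum.cong refl) (simp add: algebra_simps)
    also have "\<dots> = c * ((\<Sum>a\<in>C. w a) * (\<Sum>b\<in>C. w b)) +
        d * ((\<Sum>a\<in>C. w a * x a) * (\<Sum>b\<in>C. w b)) + d * ((\<Sum>a\<in>C. w a) * (\<Sum>b\<in>C. w b * x b)) +
        e * \<Gamma> + c * s\<^sup>2 * ((\<Sum>a\<in>C. w a * x a) * (\<Sum>b\<in>C. w b * x b))"
      unfolding \<Gamma>_def sum_product by (simp only: sum.distrib sum_distrib_left)
    also have "\<dots> = c + 2 * p * d + \<Gamma> * e + c * s\<^sup>2 * p\<^sup>2"
      unfolding px w(2) by (simp add: power2_eq_square)
    finally show ?thesis unfolding d_def e_def by simp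
  qed
  also have "\<dots> \<le> (\<Sum>a\<in>C. \<Sum>b\<in>C. w a * w b *
      ((1 - card (H b - H a) / N) * (1 - card (H a - H b) / N) *
        exp (- (card (I - H a - H b) / N))))"
    using w(1) pt by (intro sum_mono mult_left_mono) auto
  finally show ?thesis by (simp add: c_def)
qed

section \<open>Strategies\<close>

lemma space_schedule_space: "space (schedule_space n) = {1..} \<rightarrow>\<^sub>E {1..n}"
  by (simp add: schedule_space_def space_PiM)

lemma measurable_schedule_component [measurable]:
  "t \<ge> 1 \<Longrightarrow> (\<lambda>x. x t) \<in> schedule_space n \<rightarrow>\<^sub>M count_space {1..n}"
  unfolding schedule_space_def by (rule measurable_component_singleton) simp

lemma measurable_cylinder:
  assumes "I \<subseteq> {1..}" "finite I"
  shows "{x \<in> space (schedule_space n). \<forall>t\<in>I. x t = a t} \<in> sets (schedule_space n)"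
proof (rule sets.sets_Collect_finite_All[OF _ assms(2)])
  fix t assume "t \<in> I"
  then have "t \<ge> 1" using assms(1) by auto
  then have "(\<lambda>x. x t) -` ({a t} \<inter> {1..n}) \<inter> space (schedule_space n) \<in> sets (schedule_space n)"
    by (intro measurable_sets[OF measurable_schedule_component]) auto
  moreover have "(\<lambda>x. x t) -` ({a t} \<inter> {1..n}) \<inter> space (schedule_space n) =
      {x \<in> space (schedule_space n). x t = a t}"
  proof -
    have "x t \<in> {1..n}" if "x \<in> space (schedule_space n)" for x
      using that \<open>t \<ge> 1\<close> unfolding space_schedule_space by (intro PiE_mem[of x]) auto
    then show ?thesis by force
  qed
  ultimately show "{x \<in> space (schedule_space n). x t = a t} \<in> sets (schedule_space n)" by simp
qed

lemma enat_le_meeting_time_iff: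
  "enat T \<le> meeting_time x y \<pi> \<longleftrightarrow> (\<forall>t\<in>{1..<T}. x t \<noteq> \<pi> (y t))"
proof -
  have "enat T \<le> meeting_time x y \<pi> \<longleftrightarrow> (\<forall>t\<ge>1. x t = \<pi> (y t) \<longrightarrow> T \<le> t)"
    by (auto simp: meeting_time_def le_INF_iff)
  also have "\<dots> \<longleftrightarrow> (\<forall>t\<in>{1..<T}. x t \<noteq> \<pi> (y t))" by (metis atLeastLessThan_iff linorder_not_le)
  finally show ?thesis .
qed

lemma PiE_eqI_on:
  assumes "a \<in> I \<rightarrow>\<^sub>E S" "b \<in> I \<rightarrow>\<^sub>E S" "\<forall>t\<in>I. x t = a t" "\<forall>t\<in>I. x t = b t"
  shows "a = b"
  using assms(1,2) by (rule PiE_ext) (use assms(3,4) in metis)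

text \<open>The event \<open>\<tau> \<ge> T\<close> concerns only the \<open>T - 1\<close> steps
  before T, so D enters through the law of this finite prefix alone.\<close>

definition cylinder_prob :: "nat \<Rightarrow> (nat \<Rightarrow> nat) measure \<Rightarrow> (nat \<Rightarrow> nat) \<Rightarrow> real" where
  "cylinder_prob T D a = measure D {x \<in> space D. \<forall>t\<in>{1..<T}. x t = a t}"

lemma cylinder_prob_nonneg: "0 \<le> cylinder_prob T D a"
  by (simp add: cylinder_prob_def)

lemma prob_meeting_ge_nonneg: "0 \<le> prob_meeting_ge n D T"
  by (simp add: prob_meeting_ge_def)

context
  fixes n T :: nat and D :: "(nat \<Rightarrow> nat) measure"
  assumes D: "symmetric_strategy n D"
begin

interpretation prob_space D using D by (simp add: symmetric_strategy_def)

lemma sets_D: "sets D = sets (schedule_space n)"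
  using D by (simp add: symmetric_strategy_def)

lemma space_D: "space D = {1..} \<rightarrow>\<^sub>E {1..n}"
  using sets_eq_imp_space_eq[OF sets_D] by (simp add: space_schedule_space)

text \<open>For \<open>n = 0\<close> there are no schedules, and an empty space carries no
  probability measure.\<close>

lemma symmetric_strategy_pos: "0 < n"
proof -
  obtain x where "x \<in> space D" using not_empty by blast
  then have "x 1 \<in> {1..n}" unfolding space_D by (rule PiE_mem) simp
  then show ?thesis by auto
qed

lemma cylinder_in_sets: "{x \<in> space D. \<forall>t\<in>{1..<T}. x t = a t} \<in> sets D"
  using measurable_cylinder[of "{1..<T}" n a] sets_D sets_eq_imp_space_eq[OF sets_D] by auto

lemma restrict_schedule: "x \<in> space D \<Longrightarrow> restrict x {1..<T} \<in> {1..<T} \<rightarrow>\<^sub>E {1..n}"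
  by (auto simp: space_D)

lemma sum_cylinder_prob: "(\<Sum>a\<in>{1..<T} \<rightarrow>\<^sub>E {1..n}. cylinder_prob T D a) = 1"
proof -
  let ?C = "{1..<T} \<rightarrow>\<^sub>E {1..n}"
  have "(\<Sum>a\<in>?C. cylinder_prob T D a) =
      prob (\<Union>a\<in>?C. {x \<in> space D. \<forall>t\<in>{1..<T}. x t = a t})"
    unfolding cylinder_prob_def
  proof (rule finite_measure_finite_Union[symmetric])
    show "disjoint_family_on (\<lambda>a. {x \<in> space D. \<forall>t\<in>{1..<T}. x t = a t}) ?C"
      unfolding disjoint_family_on_def using PiE_eqI_on by blast
  qed (use cylinder_in_sets in \<open>auto intro!: finite_PiE\<close>)
  also have "(\<Union>a\<in>?C. {x \<in> space D. \<forall>t\<in>{1..<T}. x t = a t}) = space D"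
  proof (intro equalityI subsetI)
    fix x assume "x \<in> space D"
    then show "x \<in> (\<Union>a\<in>?C. {x \<in> space D. \<forall>t\<in>{1..<T}. x t = a t})"
      by (intro UN_I[OF restrict_schedule]) auto
  qed auto
  finally show ?thesis by (simp add: prob_space)
qed

text \<open>The event is a finite disjoint union of boxes, one for each pair of prefixes, and
  independence gives each box the product of its three probabilities.\<close>

lemma prob_meeting_ge_eq_sum:
  "prob_meeting_ge n D T =
    (\<Sum>a\<in>{1..<T} \<rightarrow>\<^sub>E {1..n}. \<Sum>b\<in>{1..<T} \<rightarrow>\<^sub>E {1..n}.
      cylinder_prob T D a * cylinder_prob T D b * no_meeting_prob {1..n} {1..<T} a b)"
proof -
  let ?C = "{1..<T} \<rightarrow>\<^sub>E {1..n}" and ?P = "{\<pi>. \<pi> permutes {1..n}}"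
  let ?U = "uniform_count_measure ?P"
  define cyl where "cyl a = {x \<in> space D. \<forall>t\<in>{1..<T}. x t = a t}" for a
  define av where "av a b = avoiding {1..n} ((\<lambda>t. (b t, a t)) ` {1..<T})" for a b :: "nat \<Rightarrow> nat"
  have finP: "finite ?P" by (simp add: finite_permutations)
  have neP: "?P \<noteq> {}" using permutes_id by blast
  interpret U: prob_space ?U by (rule prob_space_uniform_count_measure[OF finP neP])
  interpret DU: pair_prob_space D ?U ..
  interpret DDU: pair_prob_space D "D \<Otimes>\<^sub>M ?U" ..
  have avP: "av a b \<subseteq> ?P" for a b by (auto simp: av_def avoiding_def)
  have cylS: "cyl a \<in> sets D" for a unfolding cyl_def by (rule cylinder_in_sets)
  have avS: "av a b \<in> sets ?U" for a b using avP by (simp add: sets_uniform_count_measure)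
  have box: "cyl a \<times> (cyl b \<times> av a b) \<in> sets (rendezvous n D)" for a b
    unfolding rendezvous_def using cylS avS by (intro pair_measureI)
  have event: "{\<omega> \<in> space (rendezvous n D). case \<omega> of (x, y, \<pi>) \<Rightarrow> enat T \<le> meeting_time x y \<pi>} =
      (\<Union>(a, b)\<in>?C \<times> ?C. cyl a \<times> (cyl b \<times> av a b))" (is "?L = ?R")
  proof (intro equalityI subsetI)
    fix \<omega> assume "\<omega> \<in> ?L"
    then obtain x y \<pi> where \<omega>: "\<omega> = (x, y, \<pi>)" "x \<in> space D" "y \<in> space D" "\<pi> \<in> ?P"
      "\<forall>t\<in>{1..<T}. x t \<noteq> \<pi> (y t)"
      by (auto simp: rendezvous_def space_pair_measure space_uniform_count_measure
          enat_le_meeting_time_iff)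
    then have "\<omega> \<in> cyl (restrict x {1..<T}) \<times> (cyl (restrict y {1..<T}) \<times>
        av (restrict x {1..<T}) (restrict y {1..<T}))"
      by (force simp: cyl_def av_def avoiding_def)
    then show "\<omega> \<in> ?R" using restrict_schedule \<omega>(2,3) by blast
  next
    fix \<omega> assume "\<omega> \<in> ?R"
    then obtain a b x y \<pi> where "\<omega> = (x, y, \<pi>)" "x \<in> cyl a" "y \<in> cyl b" "\<pi> \<in> av a b"
      by auto
    then show "\<omega> \<in> ?L"
      by (force simp: rendezvous_def space_pair_measure space_uniform_count_measure
          enat_le_meeting_time_iff cyl_def av_def avoiding_def)
  qed
  have "prob_meeting_ge n D T = measure (rendezvous n D) ?L"
    unfolding prob_meeting_ge_def by (rule arg_cong[where f = "measure (rendezvous n D)"]) auto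
  also have "?L = ?R" by (rule event)
  also have "measure (rendezvous n D) ?R =
      (\<Sum>(a, b)\<in>?C \<times> ?C. measure (rendezvous n D) (cyl a \<times> (cyl b \<times> av a b)))"
  proof -
    have "measure (rendezvous n D) (\<Union>i\<in>?C \<times> ?C. case i of (a, b) \<Rightarrow> cyl a \<times> (cyl b \<times> av a b)) =
      (\<Sum>i\<in>?C \<times> ?C. measure (rendezvous n D) (case i of (a, b) \<Rightarrow> cyl a \<times> (cyl b \<times> av a b)))"
      unfolding rendezvous_def
    proof (rule DDU.finite_measure_finite_Union)
      show "disjoint_family_on (\<lambda>i. case i of (a, b) \<Rightarrow> cyl a \<times> (cyl b \<times> av a b)) (?C \<times> ?C)"
      proof (unfold disjoint_family_on_def, intro ballI impI)
        fix i j assume ij: "i \<in> ?C \<times> ?C" "j \<in> ?C \<times> ?C" "i \<noteq> j"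
        obtain a b a' b' where eq: "i = (a, b)" "j = (a', b')" by (cases i, cases j)
        have "c = c'" if "c \<in> ?C" "c' \<in> ?C" "z \<in> cyl c" "z \<in> cyl c'" for c c' z
          using that PiE_eqI_on[of c _ _ c' z] by (simp add: cyl_def)
        from this[of a a'] this[of b b']
        show "(case i of (a, b) \<Rightarrow> cyl a \<times> (cyl b \<times> av a b)) \<inter>
            (case j of (a, b) \<Rightarrow> cyl a \<times> (cyl b \<times> av a b)) = {}"
          using ij unfolding eq by auto
      qed
    qed (use box[unfolded rendezvous_def] in \<open>auto intro!: finite_PiE\<close>)
    then show ?thesis by (simp add: case_prod_unfold)
  qed
  also have "\<dots> = (\<Sum>(a, b)\<in>?C \<times> ?C. cylinder_prob T D a * cylinder_prob T D b *
      no_meeting_prob {1..n} {1..<T} a b)"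
  proof (intro sum.cong refl, clarify)
    fix a b
    have "measure (rendezvous n D) (cyl a \<times> (cyl b \<times> av a b)) =
        measure D (cyl a) * (measure D (cyl b) * measure ?U (av a b))"
      unfolding rendezvous_def measure_def
        DU.P.emeasure_pair_measure_Times[OF cylS pair_measureI[OF cylS avS]]
        U.emeasure_pair_measure_Times[OF cylS avS]
      by (simp add: enn2real_mult)
    also have "measure ?U (av a b) = no_meeting_prob {1..n} {1..<T} a b"
      using measure_uniform_count_measure[OF finP avP]
      by (simp add: no_meeting_prob_def av_def card_permutations)
    finally show "measure (rendezvous n D) (cyl a \<times> (cyl b \<times> av a b)) =
        cylinder_prob T D a * cylinder_prob T D b * no_meeting_prob {1..n} {1..<T} a b"
      by (simp add: cylinder_prob_def cyl_def mult.assoc)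
  qed
  also have "\<dots> = (\<Sum>a\<in>?C. \<Sum>b\<in>?C. cylinder_prob T D a * cylinder_prob T D b *
      no_meeting_prob {1..n} {1..<T} a b)"
    by (rule sum.cartesian_product[symmetric])
  finally show ?thesis .
qed

text \<open>Combines the bound for fixed schedules with the averaging; the prefix weights sum to 1,
  so the error carries over unchanged. The competing strategy is chosen after p.\<close>

lemma prob_meeting_ge_lower_bound:
  assumes T: "2 \<le> T" "T \<le> n" and k: "0 < k" "2 * k + 1 < n"
  defines "s \<equiv> (real T - 1) / n"
  shows "\<exists>p. 0 \<le> p \<and> p \<le> 1 \<and>
    p\<^sup>2 + 2 * p * (1 - p) * (1 - s) + (1 - p)\<^sup>2 * exp (- s) \<le>
      prob_meeting_ge n D T + (real n / k\<^sup>2 + (real n / (real n - 2 * k - 1) - 1))"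
proof -
  let ?C = "{1..<T} \<rightarrow>\<^sub>E {1..n}" and ?I = "{1..<T}"
  let ?w = "cylinder_prob T D" and ?H = "heavy k {1..<T}"
  let ?F = "\<lambda>a b. (1 - card (?H b - ?H a) / real n) * (1 - card (?H a - ?H b) / real n) *
    exp (- (card (?I - ?H a - ?H b) / real n))"
  define \<delta> where "\<delta> = real n / k\<^sup>2 + (real n / (real n - 2 * k - 1) - 1)"
  \<comment> \<open>The expected heavy fraction under D, later the probability of staying
    put.\<close>
  define p where "p = (\<Sum>a\<in>?C. ?w a * (card (?H a) / card ?I))"
  have HI: "?H a \<subseteq> ?I" for a :: "nat \<Rightarrow> nat" by (auto simp: heavy_def)
  have frac: "card (?H a) / card ?I \<le> 1" for a :: "nat \<Rightarrow> nat"
  proof -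
    have "card (?H a) \<le> card ?I" using HI by (intro card_mono) auto
    then have "card (?H a) / card ?I \<le> card ?I / card ?I"
      by (intro divide_right_mono of_nat_mono) auto
    then show ?thesis using T by simp
  qed
  have p0: "0 \<le> p" unfolding p_def using cylinder_prob_nonneg by (intro sum_nonneg) auto
  have "p \<le> (\<Sum>a\<in>?C. ?w a * 1)"
    unfolding p_def using frac cylinder_prob_nonneg by (intro sum_mono mult_left_mono) auto
  then have p1: "p \<le> 1" using sum_cylinder_prob by simp
  have "p\<^sup>2 + 2 * p * (1 - p) * (1 - card ?I / real n) + (1 - p)\<^sup>2 * exp (- (card ?I / real n)) \<le>
      (\<Sum>a\<in>?C. \<Sum>b\<in>?C. ?w a * ?w b * ?F a b)"
    unfolding p_def using HI cylinder_prob_nonneg sum_cylinder_prob T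
    by (intro average_meeting_ge) (auto intro!: finite_PiE)
  also have "\<dots> \<le> (\<Sum>a\<in>?C. \<Sum>b\<in>?C. ?w a * ?w b * (no_meeting_prob {1..n} ?I a b + \<delta>))"
  proof (intro sum_mono mult_left_mono)
    fix a b assume ab: "a \<in> ?C" "b \<in> ?C"
    have "?F a b - \<delta> \<le> no_meeting_prob {1..n} ?I a b"
      unfolding \<delta>_def using no_meeting_prob_ge[of "{1..n}" ?I a b k] ab T k
      by (auto simp: PiE_iff image_subset_iff)
    then show "?F a b \<le> no_meeting_prob {1..n} ?I a b + \<delta>" by simp
  qed (use cylinder_prob_nonneg in auto)
  also have "\<dots> = prob_meeting_ge n D T + (\<Sum>a\<in>?C. \<Sum>b\<in>?C. ?w a * ?w b) * \<delta>"
    unfolding prob_meeting_ge_eq_sum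
    by (simp only: distrib_left sum.distrib sum_distrib_right)
  also have "(\<Sum>a\<in>?C. \<Sum>b\<in>?C. ?w a * ?w b) = 1"
    unfolding sum_product[symmetric] sum_cylinder_prob by simp
  finally show ?thesis
    using p0 p1 T unfolding \<delta>_def s_def
    by (intro exI[of _ p]) (simp add: of_nat_diff)
qed

end

section \<open>Strategies that stay or tour\<close>

definition stay_schedule :: "nat \<Rightarrow> nat \<Rightarrow> nat" where
  "stay_schedule n = (\<lambda>t\<in>{1..}. n)"

definition tour_schedule :: "nat \<Rightarrow> nat \<Rightarrow> nat" where
  "tour_schedule n = (\<lambda>t\<in>{1..}. (t - 1) mod n + 1)"

text \<open>A single coin settles all blocks at once; for \<open>T \<le> n\<close> only the first
  block influences the event.\<close>

definition stay_or_tour :: "nat \<Rightarrow> real \<Rightarrow> (nat \<Rightarrow> nat) measure" where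
  "stay_or_tour n p = distr (measure_pmf (bernoulli_pmf p)) (schedule_space n)
    (\<lambda>stay. if stay then stay_schedule n else tour_schedule n)"

lemma bij_betw_tour_schedule:
  assumes "0 < n"
  shows "bij_betw (tour_schedule n) {j * n + 1..(j + 1) * n} {1..n}"
proof (rule bij_betwI[where g = "\<lambda>i. j * n + i"])
  have *: "tour_schedule n (j * n + i) = i" if "i \<in> {1..n}" for i
  proof -
    have "j * n + i - 1 = i - 1 + j * n" using that by auto
    then have "(j * n + i - 1) mod n = (i - 1) mod n" by simp
    also have "\<dots> = i - 1" using that by (intro mod_less) auto
    finally show ?thesis using that by (simp add: tour_schedule_def)
  qed
  then show "tour_schedule n (j * n + i) = i" if "i \<in> {1..n}" for i using that .
  show "tour_schedule n \<in> {j * n + 1..(j + 1) * n} \<rightarrow> {1..n}"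
    using assms by (auto simp: tour_schedule_def Suc_le_eq)
  show "(\<lambda>i. j * n + i) \<in> {1..n} \<rightarrow> {j * n + 1..(j + 1) * n}" by auto
  show "j * n + tour_schedule n t = t" if "t \<in> {j * n + 1..(j + 1) * n}" for t
  proof -
    have "t - j * n \<in> {1..n}" "t = j * n + (t - j * n)" using that by auto
    then show ?thesis using *[of "t - j * n"] by metis
  qed
qed

context
  fixes n :: nat and p :: real
  assumes n: "0 < n" and p: "0 \<le> p" "p \<le> 1"
begin

lemma schedules_in_space:
  "stay_schedule n \<in> space (schedule_space n)" "tour_schedule n \<in> space (schedule_space n)"
  using n by (auto simp: space_schedule_space stay_schedule_def tour_schedule_def Suc_le_eq)

lemma measurable_stay_or_tour:
  "(\<lambda>stay. if stay then stay_schedule n else tour_schedule n) \<in>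
    measure_pmf (bernoulli_pmf p) \<rightarrow>\<^sub>M schedule_space n"
  using schedules_in_space by (auto simp: measurable_def)

lemma symmetric_strategy_stay_or_tour: "symmetric_strategy n (stay_or_tour n p)"
  unfolding symmetric_strategy_def stay_or_tour_def
  using measure_pmf.prob_space_distr[OF measurable_stay_or_tour] by simp

lemma anderson_weber_type_stay_or_tour: "anderson_weber_type n (stay_or_tour n p)"
  unfolding anderson_weber_type_def
proof
  fix j
  let ?I = "{j * n + 1..(j + 1) * n}"
  let ?A = "\<lambda>a. {x \<in> space (schedule_space n). \<forall>t\<in>?I. x t = a t}"
  have A: "?A a \<in> sets (schedule_space n)" for a by (rule measurable_cylinder) auto
  \<comment> \<open>Agreement with one of the two schedules on the block is a union of two
    cylinders, hence measurable, so the almost-sure statement can be pulled back along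
    \<open>distr\<close>.\<close>
  have "{x \<in> space (schedule_space n).
      (\<forall>t\<in>?I. x t = stay_schedule n t) \<or> (\<forall>t\<in>?I. x t = tour_schedule n t)} =
    ?A (stay_schedule n) \<union> ?A (tour_schedule n)" by auto
  also have "\<dots> \<in> sets (schedule_space n)" using A by (intro sets.Un)
  finally have "AE x in stay_or_tour n p.
      (\<forall>t\<in>?I. x t = stay_schedule n t) \<or> (\<forall>t\<in>?I. x t = tour_schedule n t)"
    unfolding stay_or_tour_def by (subst AE_distr_iff[OF measurable_stay_or_tour]) auto
  then show "AE x in stay_or_tour n p. (\<forall>t\<in>?I. x t = n) \<or> bij_betw x ?I {1..n}"
  proof (rule AE_mp, intro AE_I2 impI)
    fix x assume "(\<forall>t\<in>?I. x t = stay_schedule n t) \<or> (\<forall>t\<in>?I. x t = tour_schedule n t)"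
    then show "(\<forall>t\<in>?I. x t = n) \<or> bij_betw x ?I {1..n}"
    proof
      assume "\<forall>t\<in>?I. x t = stay_schedule n t"
      then show ?thesis by (simp add: stay_schedule_def)
    next
      assume "\<forall>t\<in>?I. x t = tour_schedule n t"
      then have "bij_betw x ?I {1..n} \<longleftrightarrow> bij_betw (tour_schedule n) ?I {1..n}"
        by (intro bij_betw_cong) auto
      then show ?thesis using bij_betw_tour_schedule[OF n] by blast
    qed
  qed
qed

lemma cylinder_prob_stay_or_tour:
  "cylinder_prob T (stay_or_tour n p) a =
    p * of_bool (\<forall>t\<in>{1..<T}. stay_schedule n t = a t) +
    (1 - p) * of_bool (\<forall>t\<in>{1..<T}. tour_schedule n t = a t)"
proof -
  let ?X = "{x \<in> space (schedule_space n). \<forall>t\<in>{1..<T}. x t = a t}"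
  let ?f = "\<lambda>stay. if stay then stay_schedule n else tour_schedule n"
  have "cylinder_prob T (stay_or_tour n p) a = measure (measure_pmf (bernoulli_pmf p)) (?f -` ?X)"
  proof -
    have "measure (stay_or_tour n p) ?X =
        measure (measure_pmf (bernoulli_pmf p)) (?f -` ?X \<inter> space (measure_pmf (bernoulli_pmf p)))"
      unfolding stay_or_tour_def
      by (intro measure_distr measurable_stay_or_tour measurable_cylinder) auto
    then show ?thesis
      by (simp only: cylinder_prob_def stay_or_tour_def space_distr space_measure_pmf Int_UNIV_right)
  qed
  also have "\<dots> = (\<Sum>stay\<in>?f -` ?X. pmf (bernoulli_pmf p) stay)"
    by (rule measure_measure_pmf_finite) simp
  also have "\<dots> = (\<Sum>stay\<in>UNIV. pmf (bernoulli_pmf p) stay * of_bool (?f stay \<in> ?X))"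
    by (intro sum.mono_neutral_cong_left) auto
  also have "\<dots> = p * of_bool (stay_schedule n \<in> ?X) + (1 - p) * of_bool (tour_schedule n \<in> ?X)"
    using p by (simp add: UNIV_bool)
  finally show ?thesis using schedules_in_space by simp
qed

text \<open>The two coins give four cases: both stay, bounded by 1; one stays and the other tours, a
  star with value exactly \<open>1 - s\<close>; both tour, the diagonal bound. The result matches
  \<open>prob_meeting_ge_lower_bound\<close> term by term.\<close>

lemma prob_meeting_ge_stay_or_tour_le:
  assumes T: "1 \<le> T" "T \<le> n" "2 \<le> n"
  defines "s \<equiv> (real T - 1) / n"
  shows "prob_meeting_ge n (stay_or_tour n p) T \<le>
    p\<^sup>2 + 2 * p * (1 - p) * (1 - s) + (1 - p)\<^sup>2 * exp (- s) + 1 / (real n - 1)"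
proof -
  let ?C = "{1..<T} \<rightarrow>\<^sub>E {1..n}" and ?I = "{1..<T}"
  define c where "c = restrict (stay_schedule n) ?I"
  define r where "r = restrict (tour_schedule n) ?I"
  let ?f = "no_meeting_prob {1..n} ?I"
  have cr: "c \<in> ?C" "r \<in> ?C"
    using schedules_in_space by (auto simp: c_def r_def space_schedule_space)
  have finC: "finite ?C" by (intro finite_PiE) auto
  \<comment> \<open>For \<open>T = 1\<close> the prefixes c and r coincide, and the two indicators
    add up.\<close>
  have w: "cylinder_prob T (stay_or_tour n p) a = p * of_bool (a = c) + (1 - p) * of_bool (a = r)"
    if "a \<in> ?C" for a
  proof -
    have "(\<forall>t\<in>?I. stay_schedule n t = a t) \<longleftrightarrow> a = c" "(\<forall>t\<in>?I. tour_schedule n t = a t) \<longleftrightarrow> a = r"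
      using that by (auto simp: c_def r_def fun_eq_iff PiE_def extensional_def)
    then show ?thesis by (simp only: cylinder_prob_stay_or_tour)
  qed
  have pick: "(\<Sum>a\<in>?C. (p * of_bool (a = c) + (1 - p) * of_bool (a = r)) * h a) =
      p * h c + (1 - p) * h r" for h :: "(nat \<Rightarrow> nat) \<Rightarrow> real"
  proof -
    have "(\<Sum>a\<in>?C. (p * of_bool (a = c) + (1 - p) * of_bool (a = r)) * h a) =
      (\<Sum>a\<in>?C. (if a = c then p * h a else 0) + (if a = r then (1 - p) * h a else 0))"
      by (intro sum.cong) (auto simp: algebra_simps)
    also have "\<dots> = p * h c + (1 - p) * h r" using cr finC by (simp add: sum.distrib)
    finally show ?thesis .
  qed
  have "prob_meeting_ge n (stay_or_tour n p) T =
      (\<Sum>a\<in>?C. (p * of_bool (a = c) + (1 - p) * of_bool (a = r)) *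
        (\<Sum>b\<in>?C. (p * of_bool (b = c) + (1 - p) * of_bool (b = r)) * ?f a b))"
    unfolding prob_meeting_ge_eq_sum[OF symmetric_strategy_stay_or_tour]
    by (simp add: w sum_distrib_left mult.assoc cong: sum.cong)
  also have "\<dots> = p * (p * ?f c c + (1 - p) * ?f c r) + (1 - p) * (p * ?f r c + (1 - p) * ?f r r)"
    by (simp only: pick)
  also have "\<dots> = p\<^sup>2 * ?f c c + p * (1 - p) * (?f c r + ?f r c) + (1 - p)\<^sup>2 * ?f r r"
    by (simp add: algebra_simps power2_eq_square)
  also have "\<dots> \<le> p\<^sup>2 * 1 + p * (1 - p) * ((1 - s) + (1 - s)) +
      (1 - p)\<^sup>2 * (exp (- s) + 1 / (real n - 1))"
  proof -
    \<comment> \<open>\<open>T \<le> n\<close> keeps the prefix within the first round of the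
      tour.\<close>
    have r: "r t = t" if "t \<in> ?I" for t using that T by (auto simp: r_def tour_schedule_def)
    have inj: "inj_on r ?I" "r ` ?I \<subseteq> {1..n}" using r T by (auto simp: inj_on_def)
    have cI: "real (card ?I) = real T - 1" using T by (simp add: of_nat_diff)
    have "?f r c = ?f r (\<lambda>_. n)" "?f c r = ?f (\<lambda>_. n) r"
      by (simp_all add: no_meeting_prob_def c_def stay_schedule_def cong: image_cong_simp)
    then have "?f r c = 1 - s" "?f c r = 1 - s"
      using no_meeting_prob_const_inj[of "{1..n}" r ?I n] inj n cI by (auto simp: s_def)
    moreover have "?f r r \<le> exp (- s) + 1 / (real n - 1)"
      using no_meeting_prob_inj_le[of "{1..n}" r ?I] inj T cI by (simp add: s_def)
    moreover have "?f c c \<le> 1" by (simp add: no_meeting_prob_le_1)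
    ultimately show ?thesis using p by (intro add_mono mult_left_mono) auto
  qed
  also have "\<dots> = p\<^sup>2 + 2 * p * (1 - p) * (1 - s) + (1 - p)\<^sup>2 * exp (- s) +
      (1 - p)\<^sup>2 * (1 / (real n - 1))"
    by (simp add: algebra_simps)
  also have "(1 - p)\<^sup>2 * (1 / (real n - 1)) \<le> 1 * (1 / (real n - 1))"
    using p T by (intro mult_right_mono) (auto simp: power_le_one)
  finally show ?thesis by simp
qed

end

lemma prob_meeting_ge_le_1:
  assumes "symmetric_strategy n D"
  shows "prob_meeting_ge n D T \<le> 1"
proof -
  have "prob_meeting_ge n D T \<le> (\<Sum>a\<in>{1..<T} \<rightarrow>\<^sub>E {1..n}. \<Sum>b\<in>{1..<T} \<rightarrow>\<^sub>E {1..n}.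
      cylinder_prob T D a * cylinder_prob T D b * 1)"
    unfolding prob_meeting_ge_eq_sum[OF assms]
    by (intro sum_mono mult_left_mono no_meeting_prob_le_1) (auto simp: cylinder_prob_def)
  also have "\<dots> = 1"
    using sum_cylinder_prob[OF assms, of T] by (simp flip: sum_product)
  finally show ?thesis .
qed

lemma prob_meeting_ge_trivial:
  assumes "symmetric_strategy n D" "T \<le> 1"
  shows "prob_meeting_ge n D T = 1"
proof -
  have "{1..<T} = {}" using assms(2) by auto
  then show ?thesis
    using sum_cylinder_prob[OF assms(1), of T] unfolding prob_meeting_ge_eq_sum[OF assms(1)]
    by (simp add: no_meeting_prob_def)
qed

section \<open>The error term and the choice of the threshold\<close>

text \<open>The threshold will be \<open>n powr (3 / 4)\<close> rounded up to k, and c bounds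
  \<open>2 * k + 1\<close>. The exponent lies strictly between 1/2 and 1, so that both
  \<open>n / k\<^sup>2\<close> and \<open>k / n\<close> vanish. For small n the value 1 makes the
  claim trivial.\<close>

definition meeting_error :: "nat \<Rightarrow> real" where
  "meeting_error n = (let c = 2 * real n powr (3 / 4) + 3 in
    if c < real n
    then real n powr (- 1 / 2) + (real n / (real n - c) - 1) + 1 / (real n - 1) else 1)"

lemma meeting_error_tendsto_0: "meeting_error \<longlonglongrightarrow> 0"
proof -
  have "((\<lambda>n. real n powr (- 1 / 2) + (real n / (real n - (2 * real n powr (3 / 4) + 3)) - 1) +
      1 / (real n - 1)) \<longlongrightarrow> 0) sequentially"
    by real_asymp
  moreover have "eventually (\<lambda>n. 2 * real n powr (3 / 4) + 3 < real n) sequentially"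
    by real_asymp
  then have "eventually (\<lambda>n. real n powr (- 1 / 2) +
      (real n / (real n - (2 * real n powr (3 / 4) + 3)) - 1) + 1 / (real n - 1) =
      meeting_error n) sequentially"
    by eventually_elim (simp add: meeting_error_def Let_def)
  ultimately show ?thesis by (rule Lim_transform_eventually)
qed

theorem theorem7:
  "\<exists>\<epsilon> :: nat \<Rightarrow> real. \<epsilon> \<longlonglongrightarrow> 0 \<and>
     (\<forall>(n :: nat) (T :: nat) D. T \<le> n \<and> symmetric_strategy n D \<longrightarrow>
        (\<exists>D'. symmetric_strategy n D' \<and> anderson_weber_type n D' \<and>
              prob_meeting_ge n D' T \<le> prob_meeting_ge n D T + \<epsilon> n))"
proof (intro exI[of _ meeting_error] conjI meeting_error_tendsto_0 allI impI, elim conjE)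
  fix n T :: nat and D assume T: "T \<le> n" and D: "symmetric_strategy n D"
  have n: "0 < n" using D by (rule symmetric_strategy_pos)
  define c where "c = 2 * real n powr (3 / 4) + 3"
  have AW: "symmetric_strategy n (stay_or_tour n p)" "anderson_weber_type n (stay_or_tour n p)"
    if "0 \<le> p" "p \<le> 1" for p
    using symmetric_strategy_stay_or_tour anderson_weber_type_stay_or_tour n that by auto
  show "\<exists>D'. symmetric_strategy n D' \<and> anderson_weber_type n D' \<and>
      prob_meeting_ge n D' T \<le> prob_meeting_ge n D T + meeting_error n"
  proof (cases "c < real n")
    case False
    have "prob_meeting_ge n (stay_or_tour n 0) T \<le> prob_meeting_ge n D T + meeting_error n"
      using prob_meeting_ge_le_1[OF AW(1)[of 0], of T] prob_meeting_ge_nonneg[of n D T] False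
      by (simp add: meeting_error_def c_def)
    then show ?thesis using AW[of 0] by auto
  next
    case True
    define k where "k = nat \<lceil>real n powr (3 / 4)\<rceil>"
    have pos: "1 \<le> real n powr (3 / 4)" using n by (simp add: ge_one_powr_ge_zero)
    have kge: "real n powr (3 / 4) \<le> k" unfolding k_def by linarith
    have kle: "real k \<le> real n powr (3 / 4) + 1" using pos unfolding k_def by linarith
    have k: "0 < k" "2 * k + 1 < n"
    proof -
      have "0 < real k" using kge pos by linarith
      then show "0 < k" by simp
      have "2 * real k + 1 < real n" using kle True unfolding c_def by linarith
      then have "real (2 * k + 1) < real n" by simp
      then show "2 * k + 1 < n" by (simp only: of_nat_less_iff)
    qed
    have n2: "2 \<le> n" using k by simp
    have err: "real n / k\<^sup>2 + (real n / (real n - 2 * k - 1) - 1) + 1 / (real n - 1) \<le>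
        meeting_error n"
    proof -
      have "real n / k\<^sup>2 \<le> real n / (real n powr (3 / 4))\<^sup>2"
        using kge pos n k by (intro divide_left_mono power_mono mult_pos_pos) auto
      also have "\<dots> = real n powr (- 1 / 2)"
      proof -
        have "(real n powr (3 / 4))\<^sup>2 = real n powr (3 / 2)"
          by (simp add: powr_powr flip: powr_numeral)
        moreover have "real n powr 1 / real n powr (3 / 2) = real n powr (1 - 3 / 2)"
          by (rule powr_diff[symmetric])
        ultimately show ?thesis using n by simp
      qed
      finally have "real n / k\<^sup>2 \<le> real n powr (- 1 / 2)" .
      moreover have "real n / (real n - 2 * k - 1) \<le> real n / (real n - c)"
        using kle True by (intro divide_left_mono mult_pos_pos) (auto simp: c_def)
      ultimately show ?thesis using True by (simp add: meeting_error_def c_def)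
    qed
    show ?thesis
    proof (cases "T \<le> 1")
      \<comment> \<open>A prefix without steps has no heavy fraction, so the averaged bound starts
        at \<open>T = 2\<close>; here both probabilities are 1.\<close>
      case triv: True
      have "0 \<le> meeting_error n"
      proof (rule order_trans[OF _ err])
        show "0 \<le> real n / k\<^sup>2 + (real n / (real n - 2 * k - 1) - 1) + 1 / (real n - 1)"
          using k by (intro add_nonneg_nonneg) (auto simp: field_simps)
      qed
      then show ?thesis
        using AW[of 0] prob_meeting_ge_trivial[OF AW(1)[of 0] triv] prob_meeting_ge_trivial[OF D triv]
        by (intro exI[of _ "stay_or_tour n 0"]) simp
    next
      case False
      then obtain p where p: "0 \<le> p" "p \<le> 1" and
        lower: "p\<^sup>2 + 2 * p * (1 - p) * (1 - (real T - 1) / n) +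
          (1 - p)\<^sup>2 * exp (- ((real T - 1) / n)) \<le>
          prob_meeting_ge n D T + (real n / k\<^sup>2 + (real n / (real n - 2 * k - 1) - 1))"
        using prob_meeting_ge_lower_bound[OF D _ T k] by auto
      have "prob_meeting_ge n (stay_or_tour n p) T \<le> prob_meeting_ge n D T + meeting_error n"
        using prob_meeting_ge_stay_or_tour_le[OF n p _ T n2] lower err False by simp
      then show ?thesis using AW[OF p] by blast
    qed
  qed
qed

end
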